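(* Let $X_1,X_2,\dots$ be i.i.d. random variables with $\mathsf EX_1=0$ and $0<\sigma^2=\mathsf DX_1<\infty$, and let $S_k=X_1+\dots+X_k$ ($S_0=0$). For each $n\in\mathbb N$ let $N_{r,\alpha,1/n^{\alpha}}$ have the generalized negative binomial distribution with parameters $r,\alpha,\mu=n^{-\alpha}$, independent of $X_1,X_2,\dots$. (i) Let $r>0$, $\alpha\in\mathbb R\setminus\{0\}$. Then, as $n\to\infty$, $$\frac{S_{N_{r,\alpha,1/n^{\alpha}}}}{\sigma\sqrt n}\Longrightarrow X\cdot\sqrt{G^*_{r,\alpha,1}},$$ with $X$ and $G^*_{r,\alpha,1}$ independent. (ii) If, in addition, $r\in(0,1]$ and $\alpha\in(0,1]$, then the limit law can be represented as $$X\sqrt{G^*_{r,\alpha,1}}\stackrel{d}{=}X\sqrt{\frac{W_1}{S_{\alpha,1}Z_{r,1}^{1/\alpha}}}\stackrel{d}{=}\frac{\Lambda}{\sqrt{2S_{\alpha,1}Z_{r,1}^{1/\alpha}}},$$ where in each term the factors are independent.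
   Context: $X$ is a standard normal random variable. The generalized gamma density is $g^*(x;r,\alpha,\lambda)=\frac{|\alpha|\lambda^r}{\Gamma(r)}x^{\alpha r-1}e^{-\lambda x^{\alpha}}$, $x\ge0$ ($r,\lambda>0$, $\alpha\ne0$), and $G^*_{r,\alpha,\lambda}$ is a random variable with this density. $N_{r,\alpha,\mu}$ has the generalized negative binomial distribution $\mathsf P(N_{r,\alpha,\mu}=k)=\frac1{k!}\int_0^\infty e^{-z}z^kg^*(z;r,\alpha,\mu)dz$, $k\ge0$. $W_1$ is standard exponential; $\Lambda$ has Laplace density $\frac12e^{-|x|}$. $G_{s,1}$ is gamma with density $\frac1{\Gamma(s)}x^{s-1}e^{-x}$ ($s>0$), $G_{0,1}:=0$. For $0<\alpha\le1$, $S_{\alpha,1}$ has characteristic function $\exp\{-|t|^{\alpha}\exp(-\tfrac12 i\pi\alpha\,\mathrm{sign}\,t)\}$ (degenerate at $1$ if $\alpha=1$). $Z_{r,1}=(G_{r,1}+G_{1-r,1})/G_{r,1}$ with independent gamma factors. *)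

theory Defs
  imports "HOL-Probability.Probability"
begin

definition gen_gamma_density :: "real \<Rightarrow> real \<Rightarrow> real \<Rightarrow> real \<Rightarrow> real" where
  "gen_gamma_density r \<alpha> lam x =
     (if 0 < x then \<bar>\<alpha>\<bar> * lam powr r / Gamma r * x powr (\<alpha> * r - 1) * exp (- lam * x powr \<alpha>)
      else 0)"

definition gen_gamma_measure :: "real \<Rightarrow> real \<Rightarrow> real \<Rightarrow> real measure" where
  "gen_gamma_measure r \<alpha> lam = density lborel (gen_gamma_density r \<alpha> lam)"

definition gamma_measure :: "real \<Rightarrow> real measure" where
  "gamma_measure s =
     (if s = 0 then return borel 0
      else density lborel (\<lambda>x. if 0 < x then x powr (s - 1) * exp (- x) / Gamma s else 0))"

definition std_normal_measure :: "real measure" where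
  "std_normal_measure = density lborel std_normal_density"

definition std_exponential_measure :: "real measure" where
  "std_exponential_measure = density lborel (exponential_density 1)"

definition laplace_measure :: "real measure" where
  "laplace_measure = density lborel (\<lambda>x. exp (- \<bar>x\<bar>) / 2)"

definition gen_negbin_prob :: "real \<Rightarrow> real \<Rightarrow> real \<Rightarrow> nat \<Rightarrow> real" where
  "gen_negbin_prob r \<alpha> \<mu> k =
     1 / fact k * (\<integral>z. exp (- z) * z ^ k * gen_gamma_density r \<alpha> \<mu> z \<partial>lborel)"

text \<open>Characteristic function of the one-sided strictly stable law S_{alpha,1}.\<close>
definition stable_char :: "real \<Rightarrow> real \<Rightarrow> complex" where
  "stable_char \<alpha> t =
     exp (- complex_of_real (\<bar>t\<bar> powr \<alpha>) * exp (- \<i> * complex_of_real (pi * \<alpha> * sgn t / 2)))"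

definition limit_law :: "real \<Rightarrow> real \<Rightarrow> real measure" where
  "limit_law r \<alpha> =
     distr (std_normal_measure \<Otimes>\<^sub>M gen_gamma_measure r \<alpha> 1) borel (\<lambda>(x, g). x * sqrt g)"

text \<open>Law of X * sqrt(W_1 / (S_{alpha,1} * Z_{r,1}^(1/alpha))), all factors independent,
  with Z_{r,1} = (G_{r,1} + G_{1-r,1}) / G_{r,1}; Smu is the law of S_{alpha,1}.\<close>
definition repr_law1 :: "real measure \<Rightarrow> real \<Rightarrow> real \<Rightarrow> real measure" where
  "repr_law1 S\<mu> r \<alpha> =
     distr (std_normal_measure \<Otimes>\<^sub>M std_exponential_measure \<Otimes>\<^sub>M S\<mu> \<Otimes>\<^sub>M
            gamma_measure r \<Otimes>\<^sub>M gamma_measure (1 - r)) borel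
       (\<lambda>(x, w, s, g1, g2). x * sqrt (w / (s * ((g1 + g2) / g1) powr (1 / \<alpha>))))"

definition repr_law2 :: "real measure \<Rightarrow> real \<Rightarrow> real \<Rightarrow> real measure" where
  "repr_law2 S\<mu> r \<alpha> =
     distr (laplace_measure \<Otimes>\<^sub>M S\<mu> \<Otimes>\<^sub>M gamma_measure r \<Otimes>\<^sub>M gamma_measure (1 - r)) borel
       (\<lambda>(l, s, g1, g2). l / sqrt (2 * s * ((g1 + g2) / g1) powr (1 / \<alpha>)))"

end

theory Submission
  imports Defs "HOL-Complex_Analysis.Complex_Analysis"
begin

text \<open>
  For (i), \<open>N\<close> is a mixed Poisson variable, so the characteristic function of the normalised random
  sum is \<open>E exp (n G* (\<phi>(t / (\<sigma> \<surd>n)) - 1))\<close>, where \<open>\<phi>\<close> is the characteristic function of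
  \<open>X\<^sub>1\<close>. Since \<open>n (\<phi>(t / (\<sigma> \<surd>n)) - 1)\<close> tends to \<open>- t\<^sup>2 / 2\<close>, dominated convergence and Levy's
  continuity theorem give the limit.

  For (ii), it suffices that \<open>G*\<close> is distributed as \<open>W\<^sub>1 / (S Z\<^bsup>1/\<alpha>\<^esup>)\<close>. The tail of the latter at
  \<open>x\<close> is \<open>E exp (- x S Z\<^bsup>1/\<alpha>\<^esup>) = E exp (- x\<^bsup>\<alpha>\<^esup> Z)\<close> by the Laplace transform of the stable law, and
  \<open>E exp (- y Z)\<close> is the tail of the gamma law of shape \<open>r\<close>, of which \<open>G*\<close> is a power. The Laplace
  transform and the positivity of \<open>S\<close> are extracted from the characteristic function by means of the
  Poisson formula for bounded holomorphic functions on the upper half-plane. Finally, a Laplace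
  variable is distributed as \<open>X \<surd>(2 W\<^sub>1)\<close>.
\<close>

section \<open>The Poisson formula on the upper half-plane\<close>

text \<open>The stable law is given only by its characteristic function: neither a density nor the
  support is at hand, and \<open>E exp (- s S)\<close> could a priori be infinite. Damping by
  \<open>\<bar>x\<bar>\<close> avoids this. The function
  \<open>exp (i a x - s \<bar>x\<bar>)\<close> is bounded for either sign of \<open>x\<close>, and
  it is the average of \<open>exp (i u x)\<close> over a Cauchy law in \<open>u\<close> with centre
  \<open>a\<close> and scale \<open>s\<close>, that is, over the Poisson kernel at
  \<open>a + i s\<close>. Its expectation is therefore the Poisson integral of the characteristic
  function, which the holomorphic extension of that function evaluates. The condition \<alpha> \<le>
  1 bounds the extension: a power of exponent at most 1 maps the right half-plane into itself. The
  condition r \<le> 1 makes 1 - r an admissible shape; at r = 1 the second gamma factor is the point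
  mass at 0 and Z equals 1 almost surely. In (i) the parameter \<open>1 / n powr \<alpha>\<close>
  amounts to multiplying G* by n. All n are thereby expressed over one fixed law, which is what
  dominated convergence needs.\<close>

lemma integral_upper_halfplane_eq_0:
  fixes f :: "complex \<Rightarrow> complex"
  assumes cont: "continuous_on {z. 0 \<le> Im z} f"
    and diff: "\<And>z. 0 < Im z \<Longrightarrow> z \<notin> K \<Longrightarrow> f field_differentiable at z" and K: "finite K"
    and bound: "\<And>z. 0 \<le> Im z \<Longrightarrow> R\<^sub>0 \<le> norm z \<Longrightarrow> norm (f z) \<le> C / (norm z)\<^sup>2"
    and int: "integrable lborel (\<lambda>t::real. f (of_real t))"
  shows "(LINT t|lborel. f (of_real t)) = 0"
proof -
  define I where "I n = integral {-real n..real n} (\<lambda>t. f (of_real t))" for n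
  \<comment> \<open>The arc estimate needs a nonnegative constant; the decay bound, tested at a real
    point of modulus at least \<open>R\<^sub>0\<close>, shows that \<open>C\<close> is one.\<close>
  have C: "0 \<le> C"
  proof -
    define x where "x = max 1 R\<^sub>0"
    have "0 \<le> C / (norm (of_real x :: complex))\<^sup>2"
      by (rule order_trans[OF norm_ge_zero bound]) (auto simp: x_def)
    moreover have "x > 0" by (simp add: x_def)
    ultimately show ?thesis by (simp add: zero_le_divide_iff)
  qed
  \<comment> \<open>The semicircle has length pi R and the integrand is at most C / R^2 on it. The
    lower bound 1 on the radius keeps R positive.\<close>
  have bnd: "norm (I n) \<le> C * pi / real n" if n: "real n \<ge> max 1 R\<^sub>0" for n
  proof -
    define R where "R = real n"
    have R: "R > 0" "R \<ge> R\<^sub>0" using n by (auto simp: R_def)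
    let ?l = "linepath (of_real (-R)) (of_real R) :: real \<Rightarrow> complex"
    let ?c = "part_circlepath 0 R 0 pi"
    have l: "path_image ?l \<subseteq> {z. 0 \<le> Im z}"
      by (auto simp: closed_segment_def)
    have c: "path_image ?c \<subseteq> {z. 0 \<le> Im z}"
      using R by (auto simp: path_image_part_circlepath' closed_segment_eq_real_ivl sin_ge_zero)
    have cv: "convex {z. 0 \<le> Im z}"
      using convex_halfspace_Im_ge[of 0] by simp
    have io: "interior {z. 0 \<le> Im z} = {z. 0 < Im z}"
      using interior_halfspace_ge[of "\<i>" 0] by (simp add: inner_complex_def)
    \<comment> \<open>The diameter runs along the boundary of the half-plane. The convex form of
      Cauchy's theorem permits this: it asks for differentiability only at interior points off the
      finite set \<open>K\<close>, and for continuity elsewhere.\<close>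
    have z: "(f has_contour_integral 0) (?l +++ ?c)"
    proof (rule Cauchy_theorem_convex[OF cont cv K])
      show "f field_differentiable at x" if "x \<in> interior {z. 0 \<le> Im z} - K" for x
        using that diff by (auto simp: io)
      show "path_image (?l +++ ?c) \<subseteq> {z. 0 \<le> Im z}"
        using l c by (simp add: path_image_join)
    qed (auto intro!: valid_path_join)
    have il: "f contour_integrable_on ?l"
      by (rule contour_integrable_continuous_linepath)
         (use continuous_on_subset[OF cont l] in simp)
    have ic: "f contour_integrable_on ?c"
      by (rule contour_integrable_continuous_part_circlepath[OF continuous_on_subset[OF cont c]])
    have "contour_integral ?l f + contour_integral ?c f = 0"
      using contour_integral_join[OF il ic] contour_integral_unique[OF z] by simp
    moreover have "contour_integral ?l f = I n"
      using R by (subst contour_integral_linepath_Reals_eq) (auto simp: I_def R_def)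
    ultimately have "I n = - contour_integral ?c f" by (simp add: eq_neg_iff_add_eq_0)
    moreover have "norm (contour_integral ?c f) \<le> (C / R\<^sup>2) * R * (pi - 0)"
    proof (rule has_contour_integral_bound_part_circlepath[OF has_contour_integral_integral[OF ic]])
      fix x assume x: "x \<in> path_image ?c"
      with R have "norm x = R" using in_path_image_part_circlepath[of x 0 R 0 pi] by simp
      then show "norm (f x) \<le> C / R\<^sup>2" using bound[of x] c x R by auto
    qed (use R C in auto)
    ultimately show ?thesis using R by (simp add: R_def power2_eq_square)
  qed
  have I0: "I \<longlonglongrightarrow> 0"
  proof (rule Lim_null_comparison)
    show "\<forall>\<^sub>F n in sequentially. norm (I n) \<le> C * pi / real n"
      using bnd eventually_ge_at_top[of "nat \<lceil>max 1 R\<^sub>0\<rceil>"]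
      by (auto elim!: eventually_mono simp: nat_ceiling_le_eq)
    show "(\<lambda>n. C * pi / real n) \<longlonglongrightarrow> 0" by (rule lim_const_over_n)
  qed
  \<comment> \<open>Contour integration delivers \<open>I n\<close> as a gauge integral; dominated
    convergence needs it as a Lebesgue integral.\<close>
  have Ieq: "I n = (LINT t|lborel. indicator {-real n..real n} t *\<^sub>R f (of_real t))" for n
  proof -
    have "set_integrable lborel {-real n..real n} (\<lambda>t::real. f (of_real t))"
      unfolding set_integrable_def by (rule integrable_mult_indicator[OF _ int]) simp
    from set_borel_integral_eq_integral(2)[OF this] show ?thesis
      by (simp add: I_def set_lebesgue_integral_def)
  qed
  have "(\<lambda>n. LINT t|lborel. indicator {-real n..real n} t *\<^sub>R f (of_real t))
      \<longlonglongrightarrow> (LINT t|lborel. f (of_real t))"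
  proof (rule integral_dominated_convergence[where w="\<lambda>t. norm (f (of_real t))"])
    show "AE x in lborel. (\<lambda>n. indicat_real {- real n..real n} x *\<^sub>R f (complex_of_real x))
      \<longlonglongrightarrow> f (complex_of_real x)"
    proof (rule AE_I2)
      fix x :: real
      have "\<forall>\<^sub>F n in sequentially. indicat_real {- real n..real n} x *\<^sub>R f (of_real x) = f (of_real x)"
        using eventually_ge_at_top[of "nat \<lceil>\<bar>x\<bar>\<rceil>"]
        by (auto elim!: eventually_mono simp: nat_ceiling_le_eq abs_le_iff)
      then show "(\<lambda>n. indicat_real {- real n..real n} x *\<^sub>R f (complex_of_real x))
      \<longlonglongrightarrow> f (complex_of_real x)" by (rule tendsto_eventually)
    qed
  qed (use int in \<open>auto simp: indicator_def\<close>)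
  with I0 Ieq show ?thesis using LIMSEQ_unique by (metis (no_types, lifting) ext)
qed

text \<open>This is the Poisson kernel of the upper half-plane at \<i>. Packaged as a probability
  law, it lets Fubini and boundedness arguments apply directly.\<close>

definition cauchy_measure :: "real measure" where
  "cauchy_measure = density lborel (\<lambda>t. 1 / (pi * (1 + t\<^sup>2)))"

lemma integrable_cauchy_density: "integrable lborel (\<lambda>t::real. 1 / (pi * (1 + t\<^sup>2)))"
  and integral_cauchy_density: "(LINT t|lborel. 1 / (pi * (1 + t\<^sup>2))) = (1::real)"
proof -
  have 1: "integrable lborel (\<lambda>t::real. inverse (1 + t\<^sup>2))"
    using integrable_inverse_1_plus_square by (simp add: set_integrable_def einterval_def)
  have 2: "(LINT t|lborel. inverse (1 + t\<^sup>2)) = pi"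
    using LBINT_inverse_1_plus_square
    by (simp add: interval_lebesgue_integral_def set_lebesgue_integral_def einterval_def)
  have eq: "(\<lambda>t::real. 1 / (pi * (1 + t\<^sup>2))) = (\<lambda>t. inverse (1 + t\<^sup>2) / pi)"
    by (auto simp: field_simps)
  show "integrable lborel (\<lambda>t::real. 1 / (pi * (1 + t\<^sup>2)))" unfolding eq using 1 by simp
  show "(LINT t|lborel. 1 / (pi * (1 + t\<^sup>2))) = (1::real)" unfolding eq using 2 by simp
qed

lemma real_distribution_cauchy_measure: "real_distribution cauchy_measure"
proof -
  have "emeasure cauchy_measure (space cauchy_measure) = ennreal (LINT t|lborel. 1 / (pi * (1 + t\<^sup>2)))"
    unfolding cauchy_measure_def
    by (subst emeasure_density, simp, simp, subst nn_integral_eq_integral[symmetric])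
       (auto intro: integrable_cauchy_density)
  then have "prob_space cauchy_measure"
    by (intro prob_spaceI) (simp add: integral_cauchy_density)
  then show ?thesis
    by (simp add: real_distribution_def real_distribution_axioms_def cauchy_measure_def)
qed

text \<open>Continuity is all that Cauchy's theorem asks of the patched quotient at the exceptional
  point \<open>p\<close>.\<close>

lemma field_quotient_isCont:
  fixes F :: "complex \<Rightarrow> complex"
  assumes "(F has_field_derivative D) (at p)"
  shows "isCont (\<lambda>z. if z = p then D else (F z - F p) / (z - p)) p"
proof -
  have "((\<lambda>z. (F z - F p) / (z - p)) \<longlongrightarrow> D) (at p)"
    using assms by (simp add: has_field_derivative_iff)
  then show ?thesis
    unfolding isCont_def by (subst tendsto_cong[where g="\<lambda>z. (F z - F p) / (z - p)"])
      (auto simp: eventually_at_filter)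
qed

text \<open>The simple pole of the Poisson kernel is removed by subtracting \<open>F \<i>\<close>, so that Cauchy's
  theorem suffices and no winding number has to be computed.\<close>
lemma poisson_halfplane_i:
  fixes F :: "complex \<Rightarrow> complex"
  assumes cont: "continuous_on {z. 0 \<le> Im z} F"
    and diff: "\<And>z. 0 < Im z \<Longrightarrow> F field_differentiable at z"
    and bound: "\<And>z. 0 \<le> Im z \<Longrightarrow> norm (F z) \<le> B"
  shows "(LINT t|cauchy_measure. F (of_real t)) = F \<i>"
proof -
  obtain D where D: "(F has_field_derivative D) (at \<i>)"
    using diff[of \<i>] by (auto simp: field_differentiable_def)
  define q where "q = (\<lambda>z. if z = \<i> then D else (F z - F \<i>) / (z - \<i>))"
  \<comment> \<open>Off \<i> this is \<open>(F z - F \<i>) / (z\<^sup>2 + 1)\<close>. On the closed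
    half-plane only the factor \<open>z - \<i>\<close> can vanish, and \<open>q\<close> absorbs
    it.\<close>
  define f where "f z = q z / (z + \<i>)" for z
  have zi: "z + \<i> \<noteq> 0" if "0 \<le> Im z" for z
  proof
    assume "z + \<i> = 0"
    then have "Im (z + \<i>) = 0" by simp
    with that show False by simp
  qed
  have qc: "continuous_on {z. 0 \<le> Im z} q"
    unfolding continuous_on_eq_continuous_within
  proof
    fix z assume z: "z \<in> {z. 0 \<le> Im z}"
    show "continuous (at z within {z. 0 \<le> Im z}) q"
    proof (cases "z = \<i>")
      case True
      then show ?thesis using field_quotient_isCont[OF D] continuous_at_imp_continuous_at_within
        unfolding q_def by blast
    next
      case False
      have "continuous (at z within {z. 0 \<le> Im z}) F"
        using cont z by (simp add: continuous_on_eq_continuous_within)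
      then have *: "continuous (at z within {z. 0 \<le> Im z}) (\<lambda>z. (F z - F \<i>) / (z - \<i>))"
        using False by (auto intro!: continuous_intros)
      have "\<forall>\<^sub>F x in at z within {z. 0 \<le> Im z}. x \<noteq> \<i>"
        using False eventually_at_filter t1_space_nhds[of z "\<i>"] by (metis (mono_tags, lifting) eventually_mono)
      then have "\<forall>\<^sub>F x in at z within {z. 0 \<le> Im z}. q x = (F x - F \<i>) / (x - \<i>)"
        by (rule eventually_mono) (simp add: q_def)
      from tendsto_cong[OF this] show ?thesis
        using * False unfolding continuous_within by (simp add: q_def)
    qed
  qed
  have fc: "continuous_on {z. 0 \<le> Im z} f"
    unfolding f_def using zi by (intro continuous_intros qc) auto
  have fd: "f field_differentiable at z" if z: "0 < Im z" "z \<notin> {\<i>}" for z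
  proof -
    have ev: "\<forall>\<^sub>F w in nhds z. w \<noteq> \<i>"
      using z t1_space_nhds by auto
    have 1: "(\<lambda>z. (F z - F \<i>) / (z - \<i>) / (z + \<i>)) field_differentiable at z"
      using z zi[of z] diff by (auto intro!: derivative_intros field_differentiable_divide field_differentiable_diff field_differentiable_add)
    then obtain d where d: "((\<lambda>z. (F z - F \<i>) / (z - \<i>) / (z + \<i>)) has_field_derivative d) (at z)"
      by (auto simp: field_differentiable_def)
    have "\<forall>\<^sub>F w in nhds z. f w = (F w - F \<i>) / (w - \<i>) / (w + \<i>)"
      using ev by (rule eventually_mono) (simp add: f_def q_def)
    from d DERIV_cong_ev[OF refl this refl] have "(f has_field_derivative d) (at z)" by simp
    then show ?thesis by (auto simp: field_differentiable_def)
  qed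
  have B: "0 \<le> B" by (rule order_trans[OF norm_ge_zero bound[of 0]]) simp
  have zz: "(z - \<i>) * (z + \<i>) = z\<^sup>2 + 1" for z by (simp add: algebra_simps power2_eq_square)
  have feq: "f z = (F z - F \<i>) / (z\<^sup>2 + 1)" if "z \<noteq> \<i>" for z
    using that by (simp add: f_def q_def zz)
  have Fb: "norm (F z - F \<i>) \<le> 2 * B" if "0 \<le> Im z" for z
    using norm_triangle_ineq4[of "F z" "F \<i>"] bound[OF that] bound[of "\<i>"] by simp
  \<comment> \<open>The numerator is at most 2 B, and for \<open>norm z\<close> at least 2 the
    denominator is at least half of \<open>(norm z)\<^sup>2\<close>; hence the constant 4 B.\<close>
  have fb: "norm (f z) \<le> (4 * B) / (norm z)\<^sup>2" if z: "0 \<le> Im z" "2 \<le> norm z" for z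
  proof -
    have "z \<noteq> \<i>" using z by auto
    have n4: "4 \<le> (norm z)\<^sup>2" using power_mono[OF z(2), of 2] by simp
    have "(norm z)\<^sup>2 - 1 \<le> norm (z\<^sup>2 + 1)"
      using norm_diff_ineq[of "z\<^sup>2" 1] by (simp add: norm_power)
    then have n2: "(norm z)\<^sup>2 / 2 \<le> norm (z\<^sup>2 + 1)" using n4 by simp
    have "norm (f z) = norm (F z - F \<i>) / norm (z\<^sup>2 + 1)"
      using feq[OF \<open>z \<noteq> \<i>\<close>] by (simp add: norm_divide)
    also have "\<dots> \<le> (2 * B) / ((norm z)\<^sup>2 / 2)"
      using n2 n4 Fb[OF z(1)] B by (intro frac_le) auto
    finally show ?thesis by simp
  qed
  let ?k = "\<lambda>t::real. 1 / (pi * (1 + t\<^sup>2))"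
  have real_ne: "complex_of_real t \<noteq> \<i>" for t
    by (metis Im_complex_of_real imaginary_unit.sel(2) zero_neq_one)
  \<comment> \<open>On the real line \<open>f\<close> is pi times the Poisson kernel times
    \<open>F - F \<i>\<close>. Since its integral vanishes, the Cauchy average of \<open>F\<close>
    is \<open>F \<i>\<close>.\<close>
  have ft: "f (of_real t) = pi *\<^sub>R (?k t *\<^sub>R (F (of_real t) - F \<i>))" for t
    using feq[OF real_ne[of t]] by (simp add: scaleR_conv_of_real add.commute)
  have Fm: "(\<lambda>t::real. F (of_real t)) \<in> borel_measurable borel"
    by (intro borel_measurable_continuous_onI continuous_on_compose2[OF cont] continuous_intros) auto
  have k1: "integrable lborel (\<lambda>t. ?k t *\<^sub>R F (of_real t))"
  proof (rule Bochner_Integration.integrable_bound[OF integrable_mult_right[OF integrable_cauchy_density, of B]])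
    show "AE x in lborel. cmod ((1 / (pi * (1 + x\<^sup>2))) *\<^sub>R F (complex_of_real x))
          \<le> norm (B * (1 / (pi * (1 + x\<^sup>2))))"
    proof (rule AE_I2)
      fix x :: real
      have "cmod (?k x *\<^sub>R F (of_real x)) = ?k x * norm (F (of_real x))" by simp
      also have "\<dots> \<le> ?k x * B" using bound[of "of_real x"] by (intro mult_left_mono) auto
      finally show "cmod (?k x *\<^sub>R F (complex_of_real x)) \<le> norm (B * (?k x))"
        using B by (simp add: abs_mult)
    qed
  qed (use Fm in simp)
  have k2: "integrable lborel (\<lambda>t. ?k t *\<^sub>R F \<i>)"
    by (rule integrable_scaleR_left[OF integrable_cauchy_density])
  have fi: "integrable lborel (\<lambda>t::real. f (of_real t))"
    unfolding ft scaleR_diff_right by (intro integrable_scaleR_right Bochner_Integration.integrable_diff k1 k2)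
  have "(LINT t|lborel. f (of_real t)) = 0"
    by (rule integral_upper_halfplane_eq_0[OF fc fd _ fb fi]) auto
  then have "(LINT t|lborel. ?k t *\<^sub>R F (of_real t)) - (LINT t|lborel. ?k t *\<^sub>R F \<i>) = 0"
    unfolding ft using k1 k2
    by (simp add: scaleR_diff_right Bochner_Integration.integral_diff[OF k1 k2, symmetric] del: scaleR_scaleR)
  moreover have "(LINT t|lborel. ?k t *\<^sub>R F \<i>) = F \<i>"
    using integral_scaleR_left[OF integrable_cauchy_density, of "F \<i>"]
    by (simp add: integral_cauchy_density)
  moreover have "(LINT t|cauchy_measure. F (of_real t)) = (LINT t|lborel. ?k t *\<^sub>R F (of_real t))"
    unfolding cauchy_measure_def by (subst integral_density) (use Fm in auto)
  ultimately show ?thesis by simp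
qed

text \<open>The affine map \<open>z \<mapsto> a + s * z\<close> preserves the closed upper
  half-plane and sends \<i> to \<open>Complex a s\<close>, so the formula at \<i> transfers.\<close>

lemma poisson_halfplane:
  fixes F :: "complex \<Rightarrow> complex"
  assumes cont: "continuous_on {z. 0 \<le> Im z} F"
    and diff: "\<And>z. 0 < Im z \<Longrightarrow> F field_differentiable at z"
    and bound: "\<And>z. 0 \<le> Im z \<Longrightarrow> norm (F z) \<le> B" and s: "0 < s"
  shows "(LINT t|cauchy_measure. F (of_real (a + s * t))) = F (Complex a s)"
proof -
  let ?g = "\<lambda>z. F (of_real a + of_real s * z)"
  have "(LINT t|cauchy_measure. ?g (of_real t)) = ?g \<i>"
  proof (rule poisson_halfplane_i)
    show "continuous_on {z. 0 \<le> Im z} ?g"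
      using s by (intro continuous_on_compose2[OF cont] continuous_intros) auto
    show "?g field_differentiable at z" if "0 < Im z" for z
    proof -
      have "(F \<circ> (\<lambda>z. of_real a + of_real s * z)) field_differentiable at z"
        using that s by (intro field_differentiable_compose diff derivative_intros field_differentiable_add field_differentiable_mult field_differentiable_const field_differentiable_ident) auto
      then show ?thesis by (simp add: o_def)
    qed
    show "norm (?g z) \<le> B" if "0 \<le> Im z" for z using that s by (intro bound) auto
  qed
  moreover have "Complex a s = of_real a + of_real s * \<i>" by (simp add: complex_eq_iff)
  ultimately show ?thesis by simp
qed

section \<open>The one-sided stable law\<close>

text \<open>Holomorphic extension of \<open>stable_char\<close> to the upper half-plane.
  Multiplication by \<open>- \<i>\<close> turns that half-plane into the right one, where the
  principal power is holomorphic. On the real axis the argument of \<open>- \<i> * t\<close> is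
  \<open>- sgn t * pi / 2\<close>, which produces the phase of \<open>stable_char\<close>.\<close>

definition stable_ext :: "real \<Rightarrow> complex \<Rightarrow> complex" where
  "stable_ext \<alpha> z = exp (- ((- \<i> * z) powr of_real \<alpha>))"

lemma stable_ext_of_real: "stable_ext \<alpha> (of_real t) = stable_char \<alpha> t"
proof (cases "t = 0")
  case False
  have L: "Ln (- \<i> * of_real t) = of_real (ln \<bar>t\<bar>) + of_real (- sgn t * pi / 2) * \<i>"
  proof (cases "t > 0")
    case True
    then have "Ln (of_real t * (- \<i>)) = of_real (ln t) + Ln (- \<i>)"
      by (subst Ln_times_of_real) (auto simp: Ln_of_real)
    then show ?thesis using True by (simp add: mult.commute)
  next
    case F: False
    then have "Ln (of_real (- t) * \<i>) = of_real (ln (- t)) + Ln \<i>"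
      using False Ln_of_real[of "- t"] by (subst Ln_times_of_real) auto
    then show ?thesis using F False by (simp add: mult.commute)
  qed
  have "(- \<i> * of_real t) powr of_real \<alpha>
      = exp (of_real (\<alpha> * ln \<bar>t\<bar>) + - \<i> * of_real (pi * \<alpha> * sgn t / 2))"
    using False unfolding powr_def L by (simp add: algebra_simps)
  also have "\<dots> = of_real (\<bar>t\<bar> powr \<alpha>) * exp (- \<i> * of_real (pi * \<alpha> * sgn t / 2))"
    using False by (simp only: exp_add exp_of_real) (simp add: powr_def)
  finally show ?thesis by (simp add: stable_ext_def stable_char_def)
qed (simp add: stable_ext_def stable_char_def)

lemma stable_ext_imaginary: "0 < s \<Longrightarrow> stable_ext \<alpha> (Complex 0 s) = of_real (exp (- (s powr \<alpha>)))"
proof -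
  assume s: "0 < s"
  have "- \<i> * Complex 0 s = of_real s" by (simp add: complex_eq_iff)
  then show ?thesis using s
    by (simp add: stable_ext_def powr_of_real exp_of_real[symmetric] del: exp_of_real)
qed

lemma continuous_on_stable_ext:
  assumes "0 < \<alpha>"
  shows "continuous_on {z. 0 \<le> Im z} (stable_ext \<alpha>)"
  unfolding stable_ext_def using assms
  by (intro continuous_intros continuous_on_powr_complex) auto

lemma field_differentiable_stable_ext:
  assumes "0 < Im z"
  shows "stable_ext \<alpha> field_differentiable at z"
proof -
  have "- \<i> * z \<notin> \<real>\<^sub>\<le>\<^sub>0" using assms by (auto simp: complex_nonpos_Reals_iff)
  then show ?thesis unfolding stable_ext_def field_differentiable_def
    by (auto intro!: exI derivative_eq_intros has_field_derivative_powr[THEN DERIV_chain2] )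
qed

text \<open>The argument of \<open>- \<i> * z\<close> lies in [-pi/2, pi/2]. Multiplying it by
  \<alpha> \<le> 1 keeps it there, so the power has nonnegative real part.\<close>

lemma norm_stable_ext_le_1:
  assumes "0 < \<alpha>" "\<alpha> \<le> 1" "0 \<le> Im z"
  shows "norm (stable_ext \<alpha> z) \<le> 1"
proof (cases "z = 0")
  case False
  define w where "w = - \<i> * z"
  have w: "w \<noteq> 0" "0 \<le> Re w" using False assms by (auto simp: w_def)
  then have I: "\<bar>Im (Ln w)\<bar> \<le> pi / 2" using Re_Ln_pos_le by blast
  have "\<bar>\<alpha> * Im (Ln w)\<bar> \<le> 1 * (pi / 2)"
    unfolding abs_mult using assms I by (intro mult_mono) auto
  then have "0 \<le> cos (\<alpha> * Im (Ln w))"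
    by (intro cos_ge_zero) auto
  then have "0 \<le> Re (w powr of_real \<alpha>)"
    using w by (simp add: powr_def Re_exp)
  then show ?thesis by (simp add: stable_ext_def w_def)
qed (simp add: stable_ext_def)

text \<open>For \<open>x\<close> \<ge> 0 the function \<open>exp (\<i> * x * z)\<close> is bounded
  and holomorphic on the upper half-plane, and the Poisson formula evaluates it at
  \<open>Complex a s\<close>. For negative \<open>x\<close> it is unbounded there, so that case is
  obtained by complex conjugation from \<open>- x\<close>.\<close>

lemma cauchy_integral_iexp:
  assumes s: "0 < s"
  shows "(CLINT t|cauchy_measure. iexp ((a + s * t) * x)) = exp (Complex (- s * \<bar>x\<bar>) (a * x))"
proof -
  have pos: "(CLINT t|cauchy_measure. iexp ((a + s * t) * x)) = exp (Complex (- s * x) (a * x))"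
    if x: "0 \<le> x" for x a
  proof -
    have "(CLINT t|cauchy_measure. exp (\<i> * of_real x * of_real (a + s * t)))
       = exp (\<i> * of_real x * Complex a s)"
    proof (rule poisson_halfplane[where B=1])
      show "continuous_on {z. 0 \<le> Im z} (\<lambda>z. exp (\<i> * of_real x * z))"
        by (intro continuous_intros)
      show "(\<lambda>z. exp (\<i> * of_real x * z)) field_differentiable at z" for z
        unfolding field_differentiable_def by (auto intro!: exI derivative_eq_intros)
      show "norm (exp (\<i> * of_real x * z)) \<le> 1" if "0 \<le> Im z" for z
        using x that by simp
    qed fact
    moreover have "\<i> * of_real x * Complex a s = Complex (- s * x) (a * x)"
      by (simp add: complex_eq_iff)
    ultimately show ?thesis by (simp add: mult_ac)
  qed
  show ?thesis
  proof (cases "0 \<le> x")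
    case True with pos show ?thesis by simp
  next
    case False
    have "(CLINT t|cauchy_measure. cnj (iexp ((a + s * t) * (- x)))) = cnj (exp (Complex (s * x) (- (a * x))))"
      using pos[of "-x" a] False by (subst Bochner_Integration.integral_cnj) simp
    moreover have "cnj (iexp ((a + s * t) * (- x))) = iexp ((a + s * t) * x)" for t
      by (simp add: exp_cnj)
    moreover have "cnj (Complex (s * x) (- (a * x))) = Complex (s * x) (a * x)"
      by (simp add: complex_eq_iff)
    ultimately show ?thesis using False by (simp add: exp_cnj)
  qed
qed

text \<open>Mean value inequality on the convex left half-plane, where the derivative of
  \<open>exp\<close> has norm at most 1.\<close>

lemma norm_exp_minus_1_le:
  assumes "Re z \<le> 0"
  shows "norm (exp z - 1) \<le> norm (z::complex)"
proof -
  have "norm (exp z - exp 0) \<le> 1 * norm (z - 0)"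
  proof (rule field_differentiable_bound[where S="{z. Re z \<le> 0}" and f'=exp])
    show "convex {z. Re z \<le> 0}" using convex_halfspace_Re_le[of 0] by simp
  qed (use assms in \<open>auto intro: DERIV_exp[THEN has_field_derivative_at_within]\<close>)
  then show ?thesis by simp
qed

text \<open>Differentiation under the integral along the steps 1 / (n + 1), where \<open>w x\<close>
  is the rate of change of the exponent. The damping factor supplies the integrable bound, since
  \<open>\<bar>x\<bar> * exp (- \<bar>x\<bar>)\<close> is at most 1.\<close>

lemma tendsto_integral_difference_quotient:
  assumes M: "real_distribution M" and w[measurable]: "w \<in> borel_measurable borel"
    and wb: "\<And>x. norm (w x) \<le> \<bar>x\<bar>" "\<And>x. Re (w x) \<le> 0"
  shows "(\<lambda>n. CLINT x|M. of_real (exp (- \<bar>x\<bar>)) * ((exp (w x / real (Suc n)) - 1) * real (Suc n)))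
     \<longlonglongrightarrow> (CLINT x|M. of_real (exp (- \<bar>x\<bar>)) * w x)"
proof -
  interpret real_distribution M by fact
  have w'[measurable]: "w \<in> borel_measurable M" by simp
  have b1: "exp (- \<bar>x\<bar>) * \<bar>x\<bar> \<le> 1" for x :: real
    using exp_ge_add_one_self[of "\<bar>x\<bar>"] by (simp add: exp_minus field_simps del: exp_ge_add_one_self)
  have b2: "norm (of_real (exp (- \<bar>x\<bar>)) * v) \<le> 1" if "norm v \<le> \<bar>x\<bar>" for v :: complex and x :: real
    using order_trans[OF mult_left_mono[OF that, of "exp (- \<bar>x\<bar>)"] b1] by (simp add: norm_mult)
  have b3: "norm ((exp (w x / real (Suc n)) - 1) * real (Suc n)) \<le> \<bar>x\<bar>" for x n
  proof -
    have "norm (exp (w x / real (Suc n)) - 1) \<le> norm (w x / real (Suc n))"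
      by (rule norm_exp_minus_1_le) (use wb in \<open>simp add: Re_divide_of_real divide_nonpos_pos del: of_nat_Suc of_real_of_nat_eq\<close>)
    also have "\<dots> = norm (w x) / real (Suc n)" by (simp add: norm_divide del: of_nat_Suc)
    finally have "norm (exp (w x / real (Suc n)) - 1) * real (Suc n) \<le> norm (w x)"
      by (simp add: pos_le_divide_eq del: of_nat_Suc)
    then show ?thesis using wb(1)[of x] by (simp add: norm_mult del: of_nat_Suc)
  qed
  show "(\<lambda>n. CLINT x|M. of_real (exp (- \<bar>x\<bar>)) * ((exp (w x / real (Suc n)) - 1) * real (Suc n)))
     \<longlonglongrightarrow> (CLINT x|M. of_real (exp (- \<bar>x\<bar>)) * w x)"
  proof (rule integral_dominated_convergence[where w="\<lambda>_. 1"])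
    show "AE x in M. (\<lambda>n. of_real (exp (- \<bar>x\<bar>)) * ((exp (w x / real (Suc n)) - 1) * real (Suc n)))
        \<longlonglongrightarrow> of_real (exp (- \<bar>x\<bar>)) * w x"
    proof (intro AE_I2 tendsto_intros)
      fix x
      have "((\<lambda>h. exp (w x * h)) has_field_derivative w x) (at 0)"
        by (auto intro!: derivative_eq_intros)
      then have d: "((\<lambda>h. (exp (w x * h) - 1) / h) \<longlongrightarrow> w x) (at 0)"
        by (simp add: DERIV_def)
      have "filterlim (\<lambda>n. complex_of_real (1 / real (Suc n))) (at 0) sequentially"
        unfolding filterlim_at using LIMSEQ_inverse_real_of_nat tendsto_of_real[of _ 0]
        by (auto simp: divide_inverse simp del: of_nat_Suc of_real_inverse)
      from filterlim_compose[OF d this]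
      show "(\<lambda>n. (exp (w x / real (Suc n)) - 1) * real (Suc n)) \<longlonglongrightarrow> w x"
        by (simp del: of_nat_Suc)
    qed
    show "AE x in M. norm (of_real (exp (- \<bar>x\<bar>)) * ((exp (w x / real (Suc n)) - 1) * real (Suc n))) \<le> 1" for n
      by (intro AE_I2 b2 b3)
  qed auto
qed

context
  fixes S :: "real measure" and \<alpha> :: real
  assumes S: "real_distribution S" and charS: "\<And>t. char S t = stable_char \<alpha> t"
    and \<alpha>: "0 < \<alpha>" "\<alpha> \<le> 1"
begin

interpretation S: real_distribution S by (rule S)
interpretation C: real_distribution cauchy_measure by (rule real_distribution_cauchy_measure)
interpretation CS: pair_prob_space cauchy_measure S ..

text \<open>Both sides are Poisson integrals of the same boundary function. Fubini moves the Cauchy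
  average outside the expectation, the inner integral becomes \<open>char S\<close> on the real
  line, and the Poisson formula for \<open>stable_ext\<close> closes the argument.\<close>

lemma stable_damped_char:
  assumes s: "0 < s"
  shows "(CLINT x|S. exp (Complex (- s * \<bar>x\<bar>) (a * x))) = stable_ext \<alpha> (Complex a s)"
proof -
  have "(CLINT x|S. exp (Complex (- s * \<bar>x\<bar>) (a * x)))
      = (CLINT x|S. (CLINT t|cauchy_measure. iexp ((a + s * t) * x)))"
    by (subst cauchy_integral_iexp[OF s]) simp
  also have "\<dots> = (CLINT t|cauchy_measure. (CLINT x|S. iexp ((a + s * t) * x)))"
  proof (rule CS.Fubini_integral)
    show "integrable (cauchy_measure \<Otimes>\<^sub>M S) (\<lambda>(t, x). iexp ((a + s * t) * x))"
      by (rule CS.P.integrable_const_bound[where B=1]) (auto simp: split_beta')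
  qed
  also have "\<dots> = (CLINT t|cauchy_measure. stable_ext \<alpha> (of_real (a + s * t)))"
    using charS by (simp only: stable_ext_of_real char_def)
  also have "\<dots> = stable_ext \<alpha> (Complex a s)"
    by (rule poisson_halfplane[OF continuous_on_stable_ext field_differentiable_stable_ext
          norm_stable_ext_le_1 s]) (use \<alpha> in auto)
  finally show ?thesis .
qed

text \<open>At \<open>a = 0\<close> the oscillating factor disappears. The absolute value has to
  stay until the sign of the variable is known.\<close>

lemma stable_laplace_abs:
  assumes s: "0 < s"
  shows "(LINT x|S. exp (- s * \<bar>x\<bar>)) = exp (- (s powr \<alpha>))"
proof -
  have "Complex u 0 = of_real u" for u by (simp add: complex_eq_iff)
  then have "(CLINT x|S. of_real (exp (- s * \<bar>x\<bar>))) = complex_of_real (exp (- (s powr \<alpha>)))"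
    using stable_damped_char[OF s, of 0] unfolding stable_ext_imaginary[OF s] mult_zero_left
    by (simp only: exp_of_real)
  then show ?thesis by (simp only: integral_complex_of_real of_real_eq_iff)
qed

text \<open>The damped transform \<open>E exp (i a x - s \<bar>x\<bar>)\<close> equals the holomorphic function \<open>stable_ext\<close>
  at \<open>a + i s\<close>. Comparing its derivatives along \<open>a\<close> and along \<open>s\<close> (Cauchy-Riemann) gives
  \<open>E (\<bar>x\<bar> - x) exp (- \<bar>x\<bar>) = 0\<close>.\<close>
lemma stable_nonneg: "AE x in S. 0 \<le> x"
proof -
  obtain D where D: "(stable_ext \<alpha> has_field_derivative D) (at \<i>)"
    using field_differentiable_stable_ext[of \<i> \<alpha>] by (auto simp: field_differentiable_def)
  then have d: "((\<lambda>h. (stable_ext \<alpha> (\<i> + h) - stable_ext \<alpha> \<i>) / h) \<longlongrightarrow> D) (at 0)"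
    by (simp add: DERIV_def)
  have int: "integrable S (\<lambda>x. exp (Complex (- s * \<bar>x\<bar>) (a * x)))" if "0 < s" for s a
    using that by (intro S.integrable_const_bound[where B=1]) (auto simp: Complex_eq)
  \<comment> \<open>The unit vector \<open>c\<close> is the direction of differentiation: 1 varies
    \<open>a\<close> and \<i> varies \<open>s\<close>, and holomorphy gives \<open>c * D\<close> for
    both. Because \<open>0 \<le> Im c\<close>, the approximating points stay at height at least 1,
    where the damped formula is available.\<close>
  have lim: "(CLINT x|S. of_real (exp (- \<bar>x\<bar>)) * w x) = c * D"
    if c: "c \<noteq> 0" "\<And>x. w x = Complex (- Im c * \<bar>x\<bar>) (Re c * x)" "norm c = 1" "0 \<le> Im c" for w c
  proof -
    have lin: "exp (Complex (- (1 + Im c / real (Suc n)) * \<bar>x\<bar>) (Re c / real (Suc n) * x))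
       = of_real (exp (- \<bar>x\<bar>)) * exp (w x / real (Suc n))" for x n
      unfolding exp_of_real[symmetric] exp_add[symmetric]
      by (rule arg_cong[where f=exp]) (simp add: c(2) complex_eq_iff Re_divide_of_real Im_divide_of_real field_simps del: of_nat_Suc of_real_of_nat_eq)
    have one: "exp (Complex (- 1 * \<bar>x\<bar>) (0 * x)) = of_real (exp (- \<bar>x\<bar>))" for x
      unfolding exp_of_real[symmetric] by (rule arg_cong[where f=exp]) (simp add: complex_eq_iff)
    have "filterlim (\<lambda>n. c / complex_of_real (real (Suc n))) (at 0) sequentially"
    proof -
      have "(\<lambda>n. c * complex_of_real (inverse (real (Suc n)))) \<longlonglongrightarrow> c * of_real 0"
        by (intro tendsto_intros LIMSEQ_inverse_real_of_nat)
      then show ?thesis unfolding filterlim_at using c(1)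
        by (auto simp: divide_inverse simp del: of_nat_Suc)
    qed
    from filterlim_compose[OF d this]
    have 1: "(\<lambda>n. c * ((stable_ext \<alpha> (\<i> + c / complex_of_real (real (Suc n))) - stable_ext \<alpha> \<i>) / (c / complex_of_real (real (Suc n))))) \<longlonglongrightarrow> c * D"
      by (intro tendsto_intros)
    have 2: "c * ((stable_ext \<alpha> (\<i> + c / complex_of_real (real (Suc n))) - stable_ext \<alpha> \<i>) / (c / complex_of_real (real (Suc n))))
       = (CLINT x|S. of_real (exp (- \<bar>x\<bar>)) * ((exp (w x / real (Suc n)) - 1) * real (Suc n)))" for n
    proof -
      have pos: "0 < 1 + Im c / real (Suc n)" using c(4) by (simp add: add_pos_nonneg)
      have pt: "\<i> + c / complex_of_real (real (Suc n)) = Complex (Re c / real (Suc n)) (1 + Im c / real (Suc n))"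
        by (simp add: complex_eq_iff Re_divide_of_real Im_divide_of_real del: of_nat_Suc of_real_of_nat_eq)
      have a: "stable_ext \<alpha> (\<i> + c / complex_of_real (real (Suc n)))
         = (CLINT x|S. of_real (exp (- \<bar>x\<bar>)) * exp (w x / real (Suc n)))"
        unfolding lin[symmetric] using stable_damped_char[OF pos, of "Re c / real (Suc n)"]
        unfolding pt by simp
      have b: "stable_ext \<alpha> \<i> = (CLINT x|S. of_real (exp (- \<bar>x\<bar>)))"
        using stable_damped_char[of 1 0] unfolding one by (simp add: Complex_eq)
      have i1: "integrable S (\<lambda>x. of_real (exp (- \<bar>x\<bar>)) * exp (w x / real (Suc n)))"
        using int[OF pos, of "Re c / real (Suc n)"] unfolding lin .
      have i2: "integrable S (\<lambda>x. complex_of_real (exp (- \<bar>x\<bar>)))"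
        using int[of 1 0] unfolding one by simp
      have "c * ((stable_ext \<alpha> (\<i> + c / complex_of_real (real (Suc n))) - stable_ext \<alpha> \<i>) / (c / complex_of_real (real (Suc n))))
        = (stable_ext \<alpha> (\<i> + c / complex_of_real (real (Suc n))) - stable_ext \<alpha> \<i>) * real (Suc n)"
        using c(1) by (simp del: of_nat_Suc)
      also have "\<dots> = (CLINT x|S. (of_real (exp (- \<bar>x\<bar>)) * exp (w x / real (Suc n)) - of_real (exp (- \<bar>x\<bar>))) * real (Suc n))"
        unfolding a b Bochner_Integration.integral_diff[OF i1 i2, symmetric] by (rule integral_mult_left_zero[symmetric])
      finally show ?thesis by (simp add: algebra_simps del: of_nat_Suc)
    qed
    have 3: "norm (w x) \<le> \<bar>x\<bar>" "Re (w x) \<le> 0" for x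
    proof -
      have "(Re c)\<^sup>2 + (Im c)\<^sup>2 = 1" using c(3) by (simp add: norm_complex_def)
      then have "(Im c * \<bar>x\<bar>)\<^sup>2 + (Re c * x)\<^sup>2 = x\<^sup>2"
        by (simp add: power_mult_distrib distrib_right[symmetric] add.commute)
      then show "norm (w x) \<le> \<bar>x\<bar>" unfolding c(2) by (simp add: norm_complex_def)
      show "Re (w x) \<le> 0" using c by simp
    qed
    have wm: "w \<in> borel_measurable borel"
      unfolding c(2)[abs_def] Complex_eq by measurable
    show ?thesis
      using LIMSEQ_unique[OF tendsto_integral_difference_quotient[OF S wm 3] 1[unfolded 2]] .
  qed
  have 1: "(CLINT x|S. of_real (exp (- \<bar>x\<bar>)) * Complex 0 x) = 1 * D"
    by (rule lim) auto
  have 2: "(CLINT x|S. of_real (exp (- \<bar>x\<bar>)) * Complex (- \<bar>x\<bar>) 0) = \<i> * D"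
    by (rule lim) auto
  have e1: "of_real (exp (- \<bar>x\<bar>)) * Complex 0 x = \<i> * of_real (exp (- \<bar>x\<bar>) * x)" for x
    by (simp add: complex_eq_iff)
  have e2: "of_real (exp (- \<bar>x\<bar>)) * Complex (- \<bar>x\<bar>) 0 = - of_real (exp (- \<bar>x\<bar>) * \<bar>x\<bar>)" for x
    by (simp add: complex_eq_iff)
  have "\<i> * of_real (LINT x|S. exp (- \<bar>x\<bar>) * x) = D"
    using 1 unfolding e1 by (simp only: integral_mult_right_zero integral_complex_of_real mult_1)
  moreover have "- of_real (LINT x|S. exp (- \<bar>x\<bar>) * \<bar>x\<bar>) = \<i> * D"
    using 2 unfolding e2 by (simp only: integral_minus integral_complex_of_real)
  ultimately have "- complex_of_real (LINT x|S. exp (- \<bar>x\<bar>) * \<bar>x\<bar>) = - complex_of_real (LINT x|S. exp (- \<bar>x\<bar>) * x)"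
    by (auto simp: complex_i_mult_minus)
  then have eq: "(LINT x|S. exp (- \<bar>x\<bar>) * \<bar>x\<bar>) = (LINT x|S. exp (- \<bar>x\<bar>) * x)"
    by (simp only: neg_equal_iff_equal of_real_eq_iff)
  have b1: "exp (- \<bar>x\<bar>) * \<bar>x\<bar> \<le> 1" for x :: real
    using exp_ge_add_one_self[of "\<bar>x\<bar>"] by (simp add: exp_minus field_simps del: exp_ge_add_one_self)
  have i: "integrable S (\<lambda>x. exp (- \<bar>x\<bar>) * x)" "integrable S (\<lambda>x. exp (- \<bar>x\<bar>) * \<bar>x\<bar>)"
    using b1 by (auto intro!: S.integrable_const_bound[where B=1] simp: abs_mult)
  have "(LINT x|S. exp (- \<bar>x\<bar>) * \<bar>x\<bar> - exp (- \<bar>x\<bar>) * x) = 0"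
    using eq i by simp
  then have "AE x in S. exp (- \<bar>x\<bar>) * \<bar>x\<bar> - exp (- \<bar>x\<bar>) * x = 0"
    using i by (subst (asm) integral_nonneg_eq_0_iff_AE) (auto intro!: AE_I2 mult_left_mono)
  then show ?thesis by (rule AE_mp) (auto intro!: AE_I2)
qed

text \<open>An atom at 0 would bound the transform \<open>exp (- (s powr \<alpha>))\<close> from
  below for every \<open>s\<close>, yet it tends to 0. Strict positivity is needed because the
  variable later stands in a denominator.\<close>

lemma stable_pos: "AE x in S. 0 < x"
proof -
  have le: "S.prob {0} \<le> exp (- (real (Suc n) powr \<alpha>))" for n
  proof -
    have "S.prob {0} = (LINT x|S. indicator {0} x)" by simp
    also have "\<dots> \<le> (LINT x|S. exp (- real (Suc n) * \<bar>x\<bar>))"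
    proof (rule integral_mono)
      show "integrable S (\<lambda>x. exp (- real (Suc n) * \<bar>x\<bar>))"
        by (rule S.integrable_const_bound[where B=1]) (auto intro!: AE_I2 mult_nonpos_nonneg)
      show "integrable S (indicat_real {0})"
        by (rule integrable_real_indicator) (auto simp: S.emeasure_eq_measure)
    qed (auto simp: indicator_def)
    also have "\<dots> = exp (- (real (Suc n) powr \<alpha>))"
      by (rule stable_laplace_abs) simp
    finally show ?thesis .
  qed
  have "(\<lambda>n. exp (- (real (Suc n) powr \<alpha>))) \<longlonglongrightarrow> 0"
  proof -
    have "filterlim (\<lambda>n. real (Suc n) powr \<alpha>) at_top sequentially"
    proof -
      have "filterlim (\<lambda>n. exp (\<alpha> * ln (real (Suc n)))) at_top sequentially"
        using \<alpha> by (intro filterlim_compose[OF exp_at_top] filterlim_tendsto_pos_mult_at_top[OF tendsto_const]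
            filterlim_compose[OF ln_at_top] filterlim_compose[OF filterlim_real_sequentially filterlim_Suc])
      then show ?thesis by (simp add: powr_def)
    qed
    then show ?thesis
      by (intro filterlim_compose[OF exp_at_bot] filterlim_compose[OF filterlim_uminus_at_bot_at_top])
  qed
  then have "S.prob {0} \<le> 0" by (rule LIMSEQ_le_const) (use le in auto)
  then have "emeasure S {0} = 0" by (simp add: S.emeasure_eq_measure measure_le_0_iff)
  then have "AE x in S. x \<noteq> 0"
    by (subst AE_iff_measurable[where N="{0}"]) auto
  with stable_nonneg show ?thesis by eventually_elim auto
qed

lemma nn_integral_stable_laplace:
  assumes s: "0 < s"
  shows "(\<integral>\<^sup>+x. ennreal (exp (- s * x)) \<partial>S) = ennreal (exp (- (s powr \<alpha>)))"
proof -
  have "(\<integral>\<^sup>+x. ennreal (exp (- s * x)) \<partial>S) = (\<integral>\<^sup>+x. ennreal (exp (- s * \<bar>x\<bar>)) \<partial>S)"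
    by (rule nn_integral_cong_AE) (use stable_pos in \<open>eventually_elim, auto\<close>)
  also have "\<dots> = ennreal (LINT x|S. exp (- s * \<bar>x\<bar>))"
    using s by (intro nn_integral_eq_integral S.integrable_const_bound[where B=1]) auto
  finally show ?thesis unfolding stable_laplace_abs[OF s] .
qed

end

section \<open>Gamma and generalized gamma laws\<close>

lemma gen_gamma_density_measurable [measurable]:
  "gen_gamma_density r \<alpha> lam \<in> borel_measurable borel"
  unfolding gen_gamma_density_def by measurable

lemma sets_gamma_measure [simp, measurable_cong]: "sets (gamma_measure s) = sets borel"
  by (simp add: gamma_measure_def)

lemma space_gamma_measure [simp]: "space (gamma_measure s) = UNIV"
  by (simp add: gamma_measure_def)

lemma sets_gen_gamma_measure [simp, measurable_cong]: "sets (gen_gamma_measure r \<alpha> lam) = sets borel"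
  by (simp add: gen_gamma_measure_def)

lemma space_gen_gamma_measure [simp]: "space (gen_gamma_measure r \<alpha> lam) = UNIV"
  by (simp add: gen_gamma_measure_def)

lemma nn_integral_gamma_density:
  assumes "0 < s"
  shows "(\<integral>\<^sup>+x. ennreal (if 0 < x then x powr (s - 1) * exp (- x) / Gamma s else 0) \<partial>lborel) = 1"
proof -
  have G: "0 < Gamma s" using assms by (rule Gamma_real_pos)
  have "(\<integral>\<^sup>+x. ennreal (if 0 < x then x powr (s - 1) * exp (- x) / Gamma s else 0) \<partial>lborel)
      = (\<integral>\<^sup>+x. ennreal (1 / Gamma s) * ennreal (indicator {0..} x * x powr (s - 1) / exp x) \<partial>lborel)"
    using G by (intro nn_integral_cong)
      (auto simp: ennreal_mult[symmetric] indicator_def exp_minus field_simps)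
  also have "\<dots> = ennreal (1 / Gamma s) * ennreal (Gamma s)"
    by (subst nn_integral_cmult) (auto simp: Gamma_conv_nn_integral_real[OF assms])
  also have "\<dots> = 1" using G by (simp add: ennreal_mult[symmetric])
  finally show ?thesis .
qed

lemma real_distribution_gamma_measure:
  assumes "0 \<le> s" shows "real_distribution (gamma_measure s)"
proof -
  have "prob_space (gamma_measure s)"
  proof (cases "s = 0")
    case True
    then show ?thesis by (simp add: gamma_measure_def prob_space_return)
  next
    case False
    then show ?thesis using assms nn_integral_gamma_density[of s]
      by (intro prob_spaceI) (simp add: gamma_measure_def emeasure_density)
  qed
  then show ?thesis by (simp add: real_distribution_def real_distribution_axioms_def)
qed

lemma AE_gamma_measure_pos:
  assumes "0 < s" shows "AE x in gamma_measure s. 0 < x"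
  using assms unfolding gamma_measure_def by (simp add: AE_density)

lemma AE_gamma_measure_nonneg:
  assumes "0 \<le> s" shows "AE x in gamma_measure s. 0 \<le> x"
proof (cases "s = 0")
  case True
  then show ?thesis unfolding gamma_measure_def by (simp add: AE_return)
next
  case False
  then show ?thesis using AE_gamma_measure_pos[of s] assms by (auto elim!: eventually_mono)
qed

text \<open>Substitution of \<open>lam * x powr \<alpha>\<close> for the gamma variable on the
  positive half-line. The map is decreasing when \<alpha> is negative; the absolute Jacobian covers
  both signs and is the origin of \<open>\<bar>\<alpha>\<bar>\<close> in the density.\<close>

lemma gen_gamma_measure_eq_distr:
  assumes r: "0 < r" and \<alpha>: "\<alpha> \<noteq> 0" and l: "0 < lam"
  shows "gen_gamma_measure r \<alpha> lam = distr (gamma_measure r) borel (\<lambda>u. (u / lam) powr (1 / \<alpha>))"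
proof (rule measure_eqI)
  let ?h = "\<lambda>u::real. (u / lam) powr (1 / \<alpha>)"
  let ?g = "\<lambda>x::real. lam * x powr \<alpha>"
  let ?d = "\<lambda>x::real. if 0 < x then x powr (r - 1) * exp (- x) / Gamma r else 0"
  fix A assume "A \<in> sets (gen_gamma_measure r \<alpha> lam)"
  then have A[measurable]: "A \<in> sets borel" by simp
  have G: "0 < Gamma r" using r by (rule Gamma_real_pos)
  \<comment> \<open>The integral of \<open>f\<close> is the mass that the image law gives to
    \<open>A\<close>.\<close>
  define f where "f u = ?d u * indicator A (?h u)" for u
  have fm[measurable]: "f \<in> borel_measurable borel" unfolding f_def by measurable
  have f0: "0 \<le> f u" for u using G by (simp add: f_def)
  have di: "integrable lborel ?d"
    using nn_integral_gamma_density[OF r] G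
    by (intro integrableI_nonneg) auto
  have fi: "integrable lborel f"
    by (rule Bochner_Integration.integrable_bound[OF di]) (use G in \<open>auto simp: f_def indicator_def\<close>)
  have fa: "f absolutely_integrable_on {0<..}"
    unfolding set_integrable_def using integrable_mult_indicator[OF _ fi, of "{0<..}"]
    by (subst integrable_completion) auto
  define b where "b = integral {0<..} f"
  have S: "{0::real<..} \<in> sets lebesgue" by simp
  let ?g' = "\<lambda>x. lam * (\<alpha> * x powr (\<alpha> - 1))"
  have der: "(?g has_field_derivative ?g' x) (at x within {0<..})" if "x \<in> {0<..}" for x
    using that has_real_derivative_powr[of x \<alpha>]
    by (auto intro!: derivative_intros DERIV_cmult intro: has_field_derivative_at_within)
  have hg: "?h (?g x) = x" if "0 < x" for x
    using that l \<alpha> by (simp add: powr_powr)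
  have gh: "?g (?h x) = x" if "0 < x" for x
    using that l \<alpha> by (simp add: powr_powr)
  have inj: "inj_on ?g {0<..}" by (rule inj_on_inverseI[where g="?h"]) (use hg in auto)
  have im: "?g ` {0<..} = {0<..}"
  proof
    show "{0<..} \<subseteq> ?g ` {0<..}"
    proof
      fix x :: real assume "x \<in> {0<..}"
      then show "x \<in> ?g ` {0<..}" using gh[of x] l by (intro image_eqI[where x="?h x"]) auto
    qed
  qed (use l in auto)
  \<comment> \<open>The change of variables is a statement about gauge integrals over a set. This is
    why \<open>f\<close> was shown absolutely integrable on the half-line and why the common value
    \<open>b\<close> is transported back through \<open>has_integral\<close> below.\<close>
  have *: "(\<lambda>x. \<bar>?g' x\<bar> * f (?g x)) absolutely_integrable_on {0<..} \<and>
      integral {0<..} (\<lambda>x. \<bar>?g' x\<bar> * f (?g x)) = b"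
    by (rule iffD2[OF has_absolute_integral_change_of_variables_1'[OF S der inj]])
       (use fa b_def im in simp_all)
  \<comment> \<open>The powers of \<open>lam\<close> collect to \<open>lam powr r\<close>, and those
    of \<open>x\<close> to (\<alpha> - 1) + \<alpha> (r - 1) = \<alpha> r - 1.\<close>
  have geq: "\<bar>?g' x\<bar> * f (?g x) = gen_gamma_density r \<alpha> lam x * indicator A x" if x: "0 < x" for x
  proof -
    have "\<bar>?g' x\<bar> * (?g x) powr (r - 1) = \<bar>\<alpha>\<bar> * (lam * lam powr (r - 1)) * (x powr (\<alpha> - 1) * (x powr \<alpha>) powr (r - 1))"
      using x l by (simp add: abs_mult powr_mult)
    also have "lam * lam powr (r - 1) = lam powr r"
      using l powr_add[of lam 1 "r - 1"] by simp
    also have "x powr (\<alpha> - 1) * (x powr \<alpha>) powr (r - 1) = x powr (\<alpha> * r - 1)"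
      using x by (simp add: powr_powr powr_add[symmetric] algebra_simps)
    finally have e: "\<bar>?g' x\<bar> * (?g x) powr (r - 1) = \<bar>\<alpha>\<bar> * lam powr r * x powr (\<alpha> * r - 1)" .
    have "\<bar>?g' x\<bar> * f (?g x) = (\<bar>?g' x\<bar> * (?g x) powr (r - 1)) * exp (- ?g x) / Gamma r * indicator A x"
      using x l hg[OF x] by (simp add: f_def)
    also have "\<dots> = gen_gamma_density r \<alpha> lam x * indicator A x"
      unfolding e using x by (simp add: gen_gamma_density_def)
    finally show ?thesis .
  qed
  have H: "((\<lambda>x. gen_gamma_density r \<alpha> lam x * indicator A x) has_integral b) {0<..}"
  proof (rule has_integral_eq)
    show "((\<lambda>x. \<bar>?g' x\<bar> * f (?g x)) has_integral b) {0<..}"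
      using * set_lebesgue_integral_eq_integral(1) by (metis has_integral_integral)
  qed (use geq in auto)
  have "emeasure (gen_gamma_measure r \<alpha> lam) A = (\<integral>\<^sup>+x. indicator {0<..} x * (gen_gamma_density r \<alpha> lam x * indicator A x) \<partial>lborel)"
    unfolding gen_gamma_measure_def
    by (subst emeasure_density) (auto intro!: nn_integral_cong simp: gen_gamma_density_def indicator_def)
  also have "\<dots> = ennreal b"
    using G l by (intro nn_integral_has_integral_lebesgue H) (auto simp: gen_gamma_density_def)
  also have "\<dots> = (\<integral>\<^sup>+x. indicator {0<..} x * f x \<partial>lborel)"
  proof (rule nn_integral_has_integral_lebesgue[symmetric])
    show "(f has_integral b) {0<..}"
      using fa set_lebesgue_integral_eq_integral(1) unfolding b_def by (metis has_integral_integral)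
  qed (rule f0)
  also have "\<dots> = emeasure (distr (gamma_measure r) borel ?h) A"
    using r measurable_sets_borel[of ?h borel A] unfolding gamma_measure_def
    by (subst emeasure_distr, simp, simp, simp, subst emeasure_density)
       (auto intro!: nn_integral_cong simp: f_def indicator_def)
  finally show "emeasure (gen_gamma_measure r \<alpha> lam) A = emeasure (distr (gamma_measure r) borel ?h) A" .
qed simp

lemma real_distribution_gen_gamma_measure:
  assumes "0 < r" "\<alpha> \<noteq> 0" "0 < lam"
  shows "real_distribution (gen_gamma_measure r \<alpha> lam)"
proof -
  interpret real_distribution "gamma_measure r" using assms by (intro real_distribution_gamma_measure) simp
  show ?thesis unfolding gen_gamma_measure_eq_distr[OF assms]
    by (intro real_distribution_distr) measurable
qed

lemma AE_gen_gamma_measure_pos: "AE x in gen_gamma_measure r \<alpha> lam. 0 < x"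
  unfolding gen_gamma_measure_def by (simp add: AE_density gen_gamma_density_def)

text \<open>With \<open>c = n\<close> this explains the normalisation in the limit theorem: the
  mixing variable of \<open>N n\<close> is distributed as n times a fixed generalized gamma
  variable.\<close>

lemma gen_gamma_measure_scale:
  assumes "0 < r" "\<alpha> \<noteq> 0" "0 < c"
  shows "gen_gamma_measure r \<alpha> (1 / c powr \<alpha>) = distr (gen_gamma_measure r \<alpha> 1) borel (\<lambda>x. c * x)"
proof -
  have "gen_gamma_measure r \<alpha> (1 / c powr \<alpha>)
      = distr (gamma_measure r) borel (\<lambda>u. (u / (1 / c powr \<alpha>)) powr (1 / \<alpha>))"
    using assms by (intro gen_gamma_measure_eq_distr) auto
  also have "\<dots> = distr (gamma_measure r) borel (\<lambda>u. c * (u / 1) powr (1 / \<alpha>))"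
  proof (rule distr_cong_AE)
    show "AE u in gamma_measure r. (u / (1 / c powr \<alpha>)) powr (1 / \<alpha>) = c * (u / 1) powr (1 / \<alpha>)"
      using AE_gamma_measure_pos[OF assms(1)]
    proof eventually_elim
      case (elim u)
      then have "(u * c powr \<alpha>) powr (1 / \<alpha>) = u powr (1 / \<alpha>) * (c powr \<alpha>) powr (1 / \<alpha>)"
        by (simp add: powr_mult)
      also have "(c powr \<alpha>) powr (1 / \<alpha>) = c" using assms by (simp add: powr_powr)
      finally show ?case by simp
    qed
  qed auto
  also have "\<dots> = distr (gen_gamma_measure r \<alpha> 1) borel (\<lambda>x. c * x)"
    using assms by (subst gen_gamma_measure_eq_distr) (auto simp: distr_distr o_def)
  finally show ?thesis .
qed

lemma emeasure_gen_gamma_measure_tail: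
  assumes "0 < r" "0 < \<alpha>" "0 < x"
  shows "emeasure (gen_gamma_measure r \<alpha> 1) {x<..} = emeasure (gamma_measure r) {x powr \<alpha><..}"
proof -
  have "emeasure (gen_gamma_measure r \<alpha> 1) {x<..}
      = emeasure (gamma_measure r) ((\<lambda>u. (u / 1) powr (1 / \<alpha>)) -` {x<..} \<inter> space (gamma_measure r))"
    using assms by (subst gen_gamma_measure_eq_distr) (auto simp: emeasure_distr)
  also have "\<dots> = emeasure (gamma_measure r) {x powr \<alpha><..}"
  proof (rule emeasure_eq_AE)
    show "AE u in gamma_measure r. (u \<in> (\<lambda>u. (u / 1) powr (1 / \<alpha>)) -` {x<..} \<inter> space (gamma_measure r))
       = (u \<in> {x powr \<alpha><..})"
      using AE_gamma_measure_pos[OF assms(1)]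
    proof eventually_elim
      case (elim u)
      have "x < u powr (1 / \<alpha>) \<longleftrightarrow> x powr \<alpha> < (u powr (1 / \<alpha>)) powr \<alpha>"
        using assms by (metis less_eq_real_def not_less powr_ge_zero powr_less_mono2 powr_mono2)
      also have "(u powr (1 / \<alpha>)) powr \<alpha> = u" using assms elim by (simp add: powr_powr)
      finally show ?case by simp
    qed
    have "(\<lambda>u::real. (u / 1) powr (1 / \<alpha>)) \<in> borel_measurable (gamma_measure r)" by measurable
    then show "(\<lambda>u. (u / 1) powr (1 / \<alpha>)) -` {x<..} \<inter> space (gamma_measure r) \<in> sets (gamma_measure r)"
      by (rule measurable_sets) simp
  qed auto
  finally show ?thesis .
qed

text \<open>Exponential tilting: \<open>exp (- c * x)\<close> times the gamma density is
  \<open>(1 + c) powr (- s)\<close> times the gamma density of rate 1 + c, written here as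
  \<open>gen_gamma_density s 1 (1 + c)\<close>, whose mass is 1. The point mass \<open>s = 0\<close>
  is included because shape 1 - r vanishes at r = 1.\<close>

lemma nn_integral_gamma_laplace:
  assumes s: "0 \<le> s" and c: "0 \<le> c"
  shows "(\<integral>\<^sup>+x. ennreal (exp (- c * x)) \<partial>gamma_measure s) = ennreal ((1 + c) powr (- s))"
proof (cases "s = 0")
  case True
  then show ?thesis using c by (simp add: gamma_measure_def nn_integral_return)
next
  case False
  then have s: "0 < s" using s by simp
  have G: "0 < Gamma s" using s by (rule Gamma_real_pos)
  interpret D: real_distribution "gen_gamma_measure s 1 (1 + c)"
    using s c by (intro real_distribution_gen_gamma_measure) auto
  have one: "(\<integral>\<^sup>+x. ennreal (gen_gamma_density s 1 (1 + c) x) \<partial>lborel) = 1"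
    using D.emeasure_space_1 by (simp add: gen_gamma_measure_def emeasure_density)
  have "(\<integral>\<^sup>+x. ennreal (exp (- c * x)) \<partial>gamma_measure s)
     = (\<integral>\<^sup>+x. ennreal (if 0 < x then x powr (s - 1) * exp (- x) / Gamma s else 0) * ennreal (exp (- c * x)) \<partial>lborel)"
    using s unfolding gamma_measure_def by (simp add: nn_integral_density)
  also have "\<dots> = (\<integral>\<^sup>+x. ennreal ((1 + c) powr (- s)) * ennreal (gen_gamma_density s 1 (1 + c) x) \<partial>lborel)"
  proof (rule nn_integral_cong)
    fix x :: real
    have "exp (- x) * exp (- c * x) = exp (- (1 + c) * x)"
      by (simp add: exp_add[symmetric] algebra_simps)
    moreover have "(1 + c) powr (- s) * (1 + c) powr s = 1" using c by (simp add: powr_add[symmetric])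
    ultimately have "0 < x \<Longrightarrow> x powr (s - 1) * exp (- x) / Gamma s * exp (- c * x)
       = (1 + c) powr (- s) * gen_gamma_density s 1 (1 + c) x"
      using c by (simp add: gen_gamma_density_def mult_ac)
    then show "ennreal (if 0 < x then x powr (s - 1) * exp (- x) / Gamma s else 0) * ennreal (exp (- c * x))
       = ennreal ((1 + c) powr (- s)) * ennreal (gen_gamma_density s 1 (1 + c) x)"
      using G c by (auto simp: ennreal_mult[symmetric] gen_gamma_density_def)
  qed
  also have "\<dots> = ennreal ((1 + c) powr (- s))"
    by (subst nn_integral_cmult) (auto simp: one)
  finally show ?thesis .
qed

text \<open>Together with the exponential tail this says that a gamma variable of shape \<open>r\<close> is distributed
  as \<open>W\<^sub>1 / Z\<^sub>r\<^sub>,\<^sub>1\<close>.\<close>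
lemma nn_integral_gamma_mixture_tail:
  assumes r: "0 < r" "r \<le> 1" and y: "0 < y"
  shows "(\<integral>\<^sup>+g\<^sub>1. \<integral>\<^sup>+g\<^sub>2. ennreal (exp (- y * ((g\<^sub>1 + g\<^sub>2) / g\<^sub>1))) \<partial>gamma_measure (1 - r) \<partial>gamma_measure r)
     = emeasure (gamma_measure r) {y<..}"
proof -
  let ?d = "\<lambda>x::real. if 0 < x then x powr (r - 1) * exp (- x) / Gamma r else 0"
  have G: "0 < Gamma r" using r by (intro Gamma_real_pos)
  \<comment> \<open>For fixed \<open>g\<^sub>1\<close> the exponent splits as
    \<open>y + (y / g\<^sub>1) * g\<^sub>2\<close>, so this is a Laplace transform of the gamma law
    of shape 1 - r.\<close>
  have inner: "(\<integral>\<^sup>+g\<^sub>2. ennreal (exp (- y * ((g\<^sub>1 + g\<^sub>2) / g\<^sub>1))) \<partial>gamma_measure (1 - r))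
     = ennreal (exp (- y) * (1 + y / g\<^sub>1) powr (r - 1))" if g: "0 < g\<^sub>1" for g\<^sub>1
  proof -
    have "exp (- y * ((g\<^sub>1 + g\<^sub>2) / g\<^sub>1)) = exp (- y) * exp (- (y / g\<^sub>1) * g\<^sub>2)" for g\<^sub>2
      unfolding exp_add[symmetric] using g by (simp add: field_simps)
    then have "(\<integral>\<^sup>+g\<^sub>2. ennreal (exp (- y * ((g\<^sub>1 + g\<^sub>2) / g\<^sub>1))) \<partial>gamma_measure (1 - r))
      = (\<integral>\<^sup>+g\<^sub>2. ennreal (exp (- y)) * ennreal (exp (- (y / g\<^sub>1) * g\<^sub>2)) \<partial>gamma_measure (1 - r))"
      by (simp only: ennreal_mult exp_ge_zero)
    also have "\<dots> = ennreal (exp (- y)) * ennreal ((1 + y / g\<^sub>1) powr (- (1 - r)))"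
      using r y g by (subst nn_integral_cmult, simp, subst nn_integral_gamma_laplace) auto
    finally show ?thesis by (simp add: ennreal_mult)
  qed
  have "(\<integral>\<^sup>+g\<^sub>1. \<integral>\<^sup>+g\<^sub>2. ennreal (exp (- y * ((g\<^sub>1 + g\<^sub>2) / g\<^sub>1))) \<partial>gamma_measure (1 - r) \<partial>gamma_measure r)
     = (\<integral>\<^sup>+g. ennreal (exp (- y) * (1 + y / g) powr (r - 1)) \<partial>gamma_measure r)"
    by (rule nn_integral_cong_AE) (use AE_gamma_measure_pos[OF r(1)] inner in \<open>auto elim!: eventually_mono\<close>)
  also have "\<dots> = (\<integral>\<^sup>+g. ennreal (?d g) * ennreal (exp (- y) * (1 + y / g) powr (r - 1)) \<partial>lborel)"
    using r unfolding gamma_measure_def by (simp add: nn_integral_density)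
  also have "\<dots> = (\<integral>\<^sup>+g. ennreal (?d (y + 1 * g)) * indicator {y<..} (y + 1 * g) \<partial>lborel)"
  proof (rule nn_integral_cong)
    fix g :: real
    show "ennreal (?d g) * ennreal (exp (- y) * (1 + y / g) powr (r - 1))
      = ennreal (?d (y + 1 * g)) * indicator {y<..} (y + 1 * g)"
    proof (cases "0 < g")
      case True
      \<comment> \<open>The shape 1 - r was chosen for this product: it turns the density at
        \<open>g\<close> into the density at \<open>y + g\<close>, and integration over
        \<open>g\<close> then gives the tail beyond \<open>y\<close>.\<close>
      have "g powr (r - 1) * (1 + y / g) powr (r - 1) = (g * (1 + y / g)) powr (r - 1)"
        using True y by (simp add: powr_mult)
      also have "g * (1 + y / g) = y + g" using True by (simp add: field_simps)
      finally have e: "g powr (r - 1) * (1 + y / g) powr (r - 1) = (y + g) powr (r - 1)" .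
      have "?d g * (exp (- y) * (1 + y / g) powr (r - 1))
        = (g powr (r - 1) * (1 + y / g) powr (r - 1)) * (exp (- y) * exp (- g)) / Gamma r"
        using True by (simp add: mult_ac)
      also have "\<dots> = ?d (y + 1 * g)"
        unfolding e exp_add[symmetric] using True y by simp
      finally show ?thesis using True y G by (simp add: ennreal_mult[symmetric])
    qed auto
  qed
  also have "\<dots> = (\<integral>\<^sup>+u. ennreal (?d u) * indicator {y<..} u \<partial>lborel)"
    using nn_integral_real_affine[where f="\<lambda>u. ennreal (?d u) * indicator {y<..} u" and c=1 and t=y] by simp
  also have "\<dots> = emeasure (gamma_measure r) {y<..}"
    using r unfolding gamma_measure_def by (simp add: emeasure_density)
  finally show ?thesis .
qed

section \<open>Normal scale mixtures and the Laplace law\<close>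

lemma sets_std_measures [simp, measurable_cong]:
  "sets std_normal_measure = sets borel" "sets std_exponential_measure = sets borel"
  "sets laplace_measure = sets borel"
  by (simp_all add: std_normal_measure_def std_exponential_measure_def laplace_measure_def)

lemma space_std_measures [simp]:
  "space std_normal_measure = UNIV" "space std_exponential_measure = UNIV"
  "space laplace_measure = UNIV"
  by (simp_all add: std_normal_measure_def std_exponential_measure_def laplace_measure_def)

lemma real_distribution_std_normal_measure: "real_distribution std_normal_measure"
  unfolding std_normal_measure_def by (rule real_dist_normal_dist)

lemma real_distribution_std_exponential_measure: "real_distribution std_exponential_measure"
  using prob_space_exponential_density[of 1]
  by (simp add: real_distribution_def real_distribution_axioms_def std_exponential_measure_def)

lemma emeasure_std_exponential_tail:
  assumes "0 \<le> c"
  shows "emeasure std_exponential_measure {c<..} = ennreal (exp (- c))"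
proof -
  interpret real_distribution std_exponential_measure by (rule real_distribution_std_exponential_measure)
  have "distributed std_exponential_measure lborel (\<lambda>x. x) (exponential_density 1)"
    unfolding distributed_def by (auto simp: distr_id2 std_exponential_measure_def)
  from exponential_distributedD_gt[OF this assms] show ?thesis
    by (simp add: emeasure_eq_measure greaterThan_def)
qed

lemma gamma_measure_1: "gamma_measure 1 = std_exponential_measure"
  unfolding gamma_measure_def std_exponential_measure_def
  by (auto intro!: density_cong AE_I[where N="{0}"] simp: exponential_density_def split: if_splits)

section \<open>Equality of laws from tails, and regrouping of product measures\<close>

lemma real_distribution_eqI_tail:
  assumes "real_distribution M" "real_distribution N"
    and tail: "\<And>x. emeasure M {x<..} = emeasure N {x<..}"
  shows "M = N"
proof (rule cdf_unique[OF assms(1,2)], rule ext)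
  fix x
  have c: "cdf K x = 1 - measure K {x<..}" if "real_distribution K" for K
  proof -
    interpret real_distribution K by fact
    have "{..x} = space K - {x<..}" by auto
    then show ?thesis unfolding cdf_def2 by (simp add: prob_compl del: space_eq_univ)
  qed
  show "cdf M x = cdf N x" using c[OF assms(1)] c[OF assms(2)] tail[of x] by (simp add: measure_def)
qed

text \<open>Needed because expanding the Laplace factor into a normal and an exponential one nests
  the product to the left, while \<open>repr_law1\<close> nests it to the right. Both sides agree on
  indicators by Tonelli.\<close>

lemma pair_measure_assoc:
  assumes "sigma_finite_measure M" "sigma_finite_measure N" "sigma_finite_measure K"
  shows "distr ((M \<Otimes>\<^sub>M N) \<Otimes>\<^sub>M K) (M \<Otimes>\<^sub>M (N \<Otimes>\<^sub>M K)) (\<lambda>((x, y), z). (x, (y, z))) = M \<Otimes>\<^sub>M (N \<Otimes>\<^sub>M K)"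
    (is "?D = ?P")
proof (rule measure_eqI)
  interpret M: sigma_finite_measure M by fact
  interpret N: sigma_finite_measure N by fact
  interpret K: sigma_finite_measure K by fact
  interpret NK: pair_sigma_finite N K ..
  fix A assume "A \<in> sets ?D"
  then have A[measurable]: "A \<in> sets ?P" by simp
  have m[measurable]: "(\<lambda>((x, y), z). (x, (y, z))) \<in> measurable ((M \<Otimes>\<^sub>M N) \<Otimes>\<^sub>M K) ?P"
    unfolding split_beta' by measurable
  have "emeasure ?D A = (\<integral>\<^sup>+p. indicator A p \<partial>?D)" by simp
  also have "\<dots> = (\<integral>\<^sup>+p. indicator A ((\<lambda>((x, y), z). (x, (y, z))) p) \<partial>((M \<Otimes>\<^sub>M N) \<Otimes>\<^sub>M K))"
    by (rule nn_integral_distr) auto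
  also have "\<dots> = (\<integral>\<^sup>+q. \<integral>\<^sup>+z. indicator A ((\<lambda>((x, y), z). (x, (y, z))) (q, z)) \<partial>K \<partial>(M \<Otimes>\<^sub>M N))"
    by (rule K.nn_integral_fst[symmetric]) measurable
  also have "\<dots> = (\<integral>\<^sup>+x. \<integral>\<^sup>+y. \<integral>\<^sup>+z. indicator A ((\<lambda>((x, y), z). (x, (y, z))) ((x, y), z)) \<partial>K \<partial>N \<partial>M)"
    by (rule N.nn_integral_fst[symmetric]) measurable
  also have "\<dots> = (\<integral>\<^sup>+x. \<integral>\<^sup>+q. indicator A (x, q) \<partial>(N \<Otimes>\<^sub>M K) \<partial>M)"
  proof (rule nn_integral_cong)
    fix x assume x: "x \<in> space M"
    have "(\<integral>\<^sup>+y. \<integral>\<^sup>+z. indicator A (x, (y, z)) \<partial>K \<partial>N) = (\<integral>\<^sup>+q. indicator A (x, q) \<partial>(N \<Otimes>\<^sub>M K))"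
      using x by (intro K.nn_integral_fst) measurable
    then show "(\<integral>\<^sup>+y. \<integral>\<^sup>+z. indicator A ((\<lambda>((x, y), z). (x, (y, z))) ((x, y), z)) \<partial>K \<partial>N)
       = (\<integral>\<^sup>+q. indicator A (x, q) \<partial>(N \<Otimes>\<^sub>M K))" by simp
  qed
  also have "\<dots> = (\<integral>\<^sup>+p. indicator A p \<partial>?P)"
    by (rule NK.P.nn_integral_fst) measurable
  finally show "emeasure ?D A = emeasure ?P A" by simp
qed simp

text \<open>Truncation at 0 makes one formula serve all thresholds: for negative \<open>x\<close>
  the event has probability 1.\<close>

lemma std_exponential_quotient_tail:
  assumes d: "0 < d"
  shows "emeasure std_exponential_measure {w. x < w / d} = ennreal (exp (- (max 0 x * d)))"
proof -
  interpret real_distribution std_exponential_measure by (rule real_distribution_std_exponential_measure)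
  have eq: "{w. x < w / d} = {x * d<..}" using d by (auto simp: field_simps)
  show ?thesis
  proof (cases "0 \<le> x")
    case True
    then show ?thesis using d unfolding eq by (subst emeasure_std_exponential_tail) (auto simp: max_def)
  next
    case False
    then have "x * d \<le> 0" using d by (intro mult_nonpos_nonneg) auto
    then have "1 \<le> emeasure std_exponential_measure {x * d<..}"
      using emeasure_std_exponential_tail[of 0] False d
        emeasure_mono[of "{0<..}" "{x * d<..}" std_exponential_measure]
      by auto
    then show ?thesis using False emeasure_le_1[of "{x * d<..}"] unfolding eq by (simp add: max_def)
  qed
qed

text \<open>Integrate the normal factor first: given \<open>g\<close>, the product is centred normal
  with variance \<open>(h g)\<^sup>2\<close>. A general \<open>h\<close> covers both
  \<open>sqrt g\<close> in the limit law and \<open>sqrt (2 * w)\<close> in the Laplace law.\<close>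

lemma char_normal_scale_mixture:
  assumes P: "real_distribution P" and h[measurable]: "h \<in> borel_measurable borel"
  shows "char (distr (std_normal_measure \<Otimes>\<^sub>M P) borel (\<lambda>(x, g). x * h g)) t
     = (CLINT g|P. of_real (exp (- (t * h g)\<^sup>2 / 2)))"
proof -
  interpret P: real_distribution P by fact
  interpret N: real_distribution std_normal_measure by (rule real_distribution_std_normal_measure)
  interpret NP: pair_prob_space std_normal_measure P ..
  have h'[measurable]: "h \<in> borel_measurable P" by simp
  have "char (distr (std_normal_measure \<Otimes>\<^sub>M P) borel (\<lambda>(x, g). x * h g)) t
     = (CLINT p|(std_normal_measure \<Otimes>\<^sub>M P). iexp (t * (case p of (x, g) \<Rightarrow> x * h g)))"
    unfolding char_def by (subst integral_distr) auto
  also have "\<dots> = (CLINT p|(std_normal_measure \<Otimes>\<^sub>M P). (case p of (x, g) \<Rightarrow> iexp ((t * h g) * x)))"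
    by (rule Bochner_Integration.integral_cong) (auto simp: mult_ac)
  also have "\<dots> = (CLINT g|P. CLINT x|std_normal_measure. iexp ((t * h g) * x))"
  proof (rule NP.integral_snd[symmetric])
    show "complex_integrable (std_normal_measure \<Otimes>\<^sub>M P) (\<lambda>(x, g). iexp ((t * h g) * x))"
      by (rule NP.P.integrable_const_bound[where B=1]) (auto simp: split_beta')
  qed
  also have "\<dots> = (CLINT g|P. of_real (exp (- (t * h g)\<^sup>2 / 2)))"
  proof -
    have "(CLINT x|std_normal_measure. iexp (u * x)) = of_real (exp (- u\<^sup>2 / 2))" for u
      using fun_cong[OF char_std_normal_distribution, of u] by (simp only: std_normal_measure_def char_def)
    then show ?thesis by (simp only:)
  qed
  finally show ?thesis .
qed

lemma real_distribution_normal_scale_mixture: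
  assumes P: "real_distribution P" and h[measurable]: "h \<in> borel_measurable borel"
  shows "real_distribution (distr (std_normal_measure \<Otimes>\<^sub>M P) borel (\<lambda>(x, g). x * h g))"
proof -
  interpret P: real_distribution P by fact
  interpret N: real_distribution std_normal_measure by (rule real_distribution_std_normal_measure)
  interpret NP: pair_prob_space std_normal_measure P ..
  have h'[measurable]: "h \<in> borel_measurable P" by simp
  show ?thesis by (rule NP.P.real_distribution_distr) measurable
qed

lemma integral_exp_complex_halfline:
  shows "complex_integrable lborel (\<lambda>x. indicator {0<..} x *\<^sub>R exp (of_real x * Complex (- 1) t))"
    and "(CLINT x|lborel. indicator {0<..} x *\<^sub>R exp (of_real x * Complex (- 1) t)) = 1 / Complex 1 (- t)"
proof -
  let ?c = "Complex (- 1) t"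
  have c0: "?c \<noteq> 0" by (simp add: complex_eq_iff)
  have d: "integrable lborel (exponential_density 1)"
  proof -
    interpret real_distribution std_exponential_measure by (rule real_distribution_std_exponential_measure)
    have "(\<integral>\<^sup>+x. ennreal (exponential_density 1 x) \<partial>lborel) = 1"
      using emeasure_space_1 by (simp add: std_exponential_measure_def emeasure_density)
    then show ?thesis by (intro integrableI_nonneg) (auto simp: exponential_density_def)
  qed
  show i: "complex_integrable lborel (\<lambda>x. indicator {0<..} x *\<^sub>R exp (of_real x * ?c))"
    by (rule Bochner_Integration.integrable_bound[OF d])
       (auto simp: indicator_def exponential_density_def)
  have I: "(CLINT x|lborel. indicator {0..real n} x *\<^sub>R exp (of_real x * ?c)) = exp (of_real (real n) * ?c) / ?c - 1 / ?c" for n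
  proof -
    have "(CLINT x|lborel. indicator {0..real n} x *\<^sub>R exp (of_real x * ?c)) = exp (of_real (real n) * ?c) / ?c - exp (of_real 0 * ?c) / ?c"
    proof (rule integral_FTC_Icc)
      show "((\<lambda>x. exp (of_real x * ?c) / ?c) has_vector_derivative exp (of_real x * ?c)) (at x within {0..real n})" for x
      proof -
        have "((\<lambda>x. exp (x * ?c) / ?c) has_field_derivative exp (of_real x * ?c)) (at (of_real x))"
          using c0 by (auto intro!: derivative_eq_intros)
        then show ?thesis by (rule has_vector_derivative_at_within[OF has_vector_derivative_real_field])
      qed
    qed (auto intro!: continuous_intros)
    then show ?thesis by simp
  qed
  have L: "(\<lambda>n. CLINT x|lborel. indicator {0..real n} x *\<^sub>R exp (of_real x * ?c))
     \<longlonglongrightarrow> (CLINT x|lborel. indicator {0<..} x *\<^sub>R exp (of_real x * ?c))"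
  proof (rule integral_dominated_convergence[OF _ _ d])
    \<comment> \<open>The indicators of \<open>{0..real n}\<close> and \<open>{0<..}\<close>
      disagree at 0 for every n, so the convergence is claimed only off that null point.\<close>
    show "AE x in lborel. (\<lambda>n. indicat_real {0..real n} x *\<^sub>R exp (of_real x * ?c))
       \<longlonglongrightarrow> indicat_real {0<..} x *\<^sub>R exp (of_real x * ?c)"
      using AE_lborel_singleton[of "0::real"]
    proof eventually_elim
      case (elim x)
      have "\<forall>\<^sub>F n in sequentially. indicat_real {0..real n} x *\<^sub>R exp (of_real x * ?c)
        = indicat_real {0<..} x *\<^sub>R exp (of_real x * ?c)"
        using eventually_ge_at_top[of "nat \<lceil>x\<rceil>"] elim
        by (auto elim!: eventually_mono simp: nat_ceiling_le_eq indicator_def)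
      then show ?case by (rule tendsto_eventually)
    qed
  qed (auto simp: indicator_def exponential_density_def)
  have "(\<lambda>n. exp (of_real (real n) * ?c) / ?c - 1 / ?c) \<longlonglongrightarrow> 0 / ?c - 1 / ?c"
  proof (intro tendsto_intros c0)
    have "(\<lambda>n. exp (- real n)) \<longlonglongrightarrow> 0"
      by (intro filterlim_compose[OF exp_at_bot] filterlim_compose[OF filterlim_uminus_at_bot_at_top] filterlim_real_sequentially)
    then show "(\<lambda>n. exp (of_real (real n) * ?c)) \<longlonglongrightarrow> 0"
      by (subst tendsto_norm_zero_iff[symmetric]) simp
  qed
  from LIMSEQ_unique[OF L this[folded I]]
  show "(CLINT x|lborel. indicator {0<..} x *\<^sub>R exp (of_real x * ?c)) = 1 / Complex 1 (- t)"
    by (simp add: complex_eq_iff Re_divide Im_divide)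
qed

text \<open>Split at 0 and reflect the negative half: the value is the mean of 1 / (1 - i t) and 1 /
  (1 + i t). At \<open>t = 0\<close> it gives the total mass of the Laplace density.\<close>

lemma laplace_fourier:
  shows "complex_integrable lborel (\<lambda>x. (exp (- \<bar>x\<bar>) / 2) *\<^sub>R iexp (t * x))"
    and "(CLINT x|lborel. (exp (- \<bar>x\<bar>) / 2) *\<^sub>R iexp (t * x)) = of_real (1 / (1 + t\<^sup>2))"
proof -
  let ?f = "\<lambda>t x. indicator {0<..} x *\<^sub>R exp (of_real x * Complex (- 1) t)"
  have ae: "AE x in lborel. (?f t x + ?f (- t) (0 + (- 1) * x)) / 2 = (exp (- \<bar>x\<bar>) / 2) *\<^sub>R iexp (t * x)"
    using AE_lborel_singleton[of "0::real"]
  proof eventually_elim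
    case (elim x)
    have "exp (of_real x * Complex (- 1) t) = exp (- x) *\<^sub>R iexp (t * x)"
      "exp (- of_real x * Complex (- 1) (- t)) = exp x *\<^sub>R iexp (t * x)"
      unfolding scaleR_conv_of_real exp_of_real[symmetric] exp_add[symmetric]
      by (intro arg_cong[where f=exp]; simp add: complex_eq_iff)+
    then show ?case using elim by (cases "0 < x") (auto simp: scaleR_conv_of_real)
  qed
  have i: "complex_integrable lborel (\<lambda>x. (?f t x + ?f (- t) (0 + (- 1) * x)) / 2)"
    by (intro integrable_divide_zero Bochner_Integration.integrable_add integral_exp_complex_halfline(1)
        lborel_integrable_real_affine) auto
  show "complex_integrable lborel (\<lambda>x. (exp (- \<bar>x\<bar>) / 2) *\<^sub>R iexp (t * x))"
    by (rule integrable_cong_AE_imp[OF i _ ae]) measurable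
  have "(CLINT x|lborel. (exp (- \<bar>x\<bar>) / 2) *\<^sub>R iexp (t * x)) = (CLINT x|lborel. (?f t x + ?f (- t) (0 + (- 1) * x)) / 2)"
    by (rule integral_cong_AE) (use ae in auto)
  also have "\<dots> = ((CLINT x|lborel. ?f t x) + (CLINT x|lborel. ?f (- t) (0 + (- 1) * x))) / 2"
    by (subst integral_divide_zero, subst Bochner_Integration.integral_add)
      (intro integral_exp_complex_halfline(1) lborel_integrable_real_affine refl; simp)+
  also have "(CLINT x|lborel. ?f (- t) (0 + (- 1) * x)) = (CLINT x|lborel. ?f (- t) x)"
    using lborel_integral_real_affine[of "-1" "?f (- t)" 0] by simp
  also have "((CLINT x|lborel. ?f t x) + (CLINT x|lborel. ?f (- t) x)) / 2 = of_real (1 / (1 + t\<^sup>2))"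
  proof -
    have "1 / Complex 1 (- t) + 1 / Complex 1 (- (- t)) = 2 * of_real (1 / (1 + t\<^sup>2))"
    proof -
      have "Complex 1 (- t) * Complex 1 t = of_real (1 + t\<^sup>2)"
        by (simp add: complex_eq_iff power2_eq_square)
      moreover have "Complex 1 (- t) + Complex 1 t = 2" by (simp add: complex_eq_iff)
      moreover have "Complex 1 (- t) \<noteq> 0" "Complex 1 t \<noteq> 0" by (simp_all add: complex_eq_iff)
      then have "1 / Complex 1 (- t) + 1 / Complex 1 (- (- t)) = (Complex 1 (- t) + Complex 1 t) / (Complex 1 (- t) * Complex 1 t)"
        by (simp add: add_frac_eq add.commute)
      ultimately show ?thesis by simp
    qed
    then show ?thesis unfolding integral_exp_complex_halfline(2)
      by (simp only: nonzero_mult_div_cancel_left[OF zero_neq_numeral[symmetric]])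
  qed
  finally show "(CLINT x|lborel. (exp (- \<bar>x\<bar>) / 2) *\<^sub>R iexp (t * x)) = of_real (1 / (1 + t\<^sup>2))" .
qed

lemma real_distribution_laplace_measure: "real_distribution laplace_measure"
proof -
  have 1: "complex_integrable lborel (\<lambda>x. complex_of_real (exp (- \<bar>x\<bar>) / 2))"
    "(CLINT x|lborel. complex_of_real (exp (- \<bar>x\<bar>) / 2)) = 1"
    using laplace_fourier[of 0] by (simp_all add: scaleR_conv_of_real)
  then have i: "integrable lborel (\<lambda>x::real. exp (- \<bar>x\<bar>) / 2)"
    using complex_of_real_integrable_eq by blast
  have "complex_of_real (LINT x|lborel. exp (- \<bar>x\<bar>) / 2) = complex_of_real 1"
    using 1(2) by (simp only: integral_complex_of_real of_real_1)
  then have "(LINT x|lborel. exp (- \<bar>x\<bar>) / 2) = (1::real)" by (simp only: of_real_eq_iff)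
  then have "emeasure laplace_measure (space laplace_measure) = 1"
    using nn_integral_eq_integral[OF i] by (simp add: laplace_measure_def emeasure_density)
  then have "prob_space laplace_measure" by (rule prob_spaceI)
  then show ?thesis by (simp add: real_distribution_def real_distribution_axioms_def)
qed

text \<open>Both characteristic functions are \<open>1 / (1 + t\<^sup>2)\<close>: given the
  exponential variable \<open>w\<close>, the mixture contributes
  \<open>exp (- t\<^sup>2 * w)\<close>, and the exponential law has Laplace transform 1 / (1 +
  c).\<close>

lemma laplace_measure_eq_normal_mixture:
  "laplace_measure = distr (std_normal_measure \<Otimes>\<^sub>M std_exponential_measure) borel (\<lambda>(x, w). x * sqrt (2 * w))"
proof (rule Levy_uniqueness)
  show "real_distribution laplace_measure" by (rule real_distribution_laplace_measure)
  show "real_distribution (distr (std_normal_measure \<Otimes>\<^sub>M std_exponential_measure) borel (\<lambda>(x, w). x * sqrt (2 * w)))"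
    by (rule real_distribution_normal_scale_mixture[OF real_distribution_std_exponential_measure]) measurable
  show "char laplace_measure = char (distr (std_normal_measure \<Otimes>\<^sub>M std_exponential_measure) borel (\<lambda>(x, w). x * sqrt (2 * w)))"
  proof
    fix t
    interpret W: real_distribution std_exponential_measure by (rule real_distribution_std_exponential_measure)
    have "char laplace_measure t = of_real (1 / (1 + t\<^sup>2))"
      unfolding char_def laplace_measure_def
      by (subst integral_density, (rule laplace_fourier(2) | simp)+)
    have pos: "AE w in std_exponential_measure. 0 < w"
      unfolding gamma_measure_1[symmetric] by (rule AE_gamma_measure_pos) simp
    have "char (distr (std_normal_measure \<Otimes>\<^sub>M std_exponential_measure) borel (\<lambda>(x, w). x * sqrt (2 * w))) t
      = (CLINT w|std_exponential_measure. of_real (exp (- (t * sqrt (2 * w))\<^sup>2 / 2)))"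
      by (rule char_normal_scale_mixture[OF real_distribution_std_exponential_measure]) measurable
    also have "\<dots> = of_real (LINT w|std_exponential_measure. exp (- (t * sqrt (2 * w))\<^sup>2 / 2))"
      by (rule integral_complex_of_real)
    also have "(LINT w|std_exponential_measure. exp (- (t * sqrt (2 * w))\<^sup>2 / 2))
      = (LINT w|std_exponential_measure. exp (- t\<^sup>2 * w))"
      by (rule integral_cong_AE, measurable)
         (use pos in \<open>eventually_elim, simp add: power_mult_distrib\<close>)
    also have "\<dots> = enn2real (\<integral>\<^sup>+w. ennreal (exp (- t\<^sup>2 * w)) \<partial>std_exponential_measure)"
      by (rule integral_eq_nn_integral) auto
    also have "\<dots> = 1 / (1 + t\<^sup>2)"
      using nn_integral_gamma_laplace[of 1 "t\<^sup>2"] unfolding gamma_measure_1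
      by (simp add: powr_minus add_nonneg_nonneg divide_inverse)
    finally show "char laplace_measure t = char (distr (std_normal_measure \<Otimes>\<^sub>M std_exponential_measure) borel (\<lambda>(x, w). x * sqrt (2 * w))) t"
      using \<open>char laplace_measure t = of_real (1 / (1 + t\<^sup>2))\<close> by simp
  qed
qed

section \<open>Random sums\<close>

lemma real_distribution_limit_law:
  assumes "0 < r" "\<alpha> \<noteq> 0"
  shows "real_distribution (limit_law r \<alpha>)"
  unfolding limit_law_def using assms
  by (intro real_distribution_normal_scale_mixture real_distribution_gen_gamma_measure) auto

text \<open>The exponent is written as \<open>g\<close> times a complex constant, to match the limit
  in \<open>gen_gamma_mixture_limit\<close>.\<close>

lemma char_limit_law:
  assumes "0 < r" "\<alpha> \<noteq> 0"
  shows "char (limit_law r \<alpha>) t = (CLINT g|gen_gamma_measure r \<alpha> 1. exp (of_real g * of_real (- t\<^sup>2 / 2)))"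
proof -
  have "char (limit_law r \<alpha>) t = (CLINT g|gen_gamma_measure r \<alpha> 1. of_real (exp (- (t * sqrt g)\<^sup>2 / 2)))"
    unfolding limit_law_def using assms
    by (intro char_normal_scale_mixture real_distribution_gen_gamma_measure) auto
  also have "\<dots> = (CLINT g|gen_gamma_measure r \<alpha> 1. exp (of_real g * of_real (- t\<^sup>2 / 2)))"
  proof (rule integral_cong_AE)
    show "AE g in gen_gamma_measure r \<alpha> 1. complex_of_real (exp (- (t * sqrt g)\<^sup>2 / 2))
       = exp (of_real g * of_real (- t\<^sup>2 / 2))"
      using AE_gen_gamma_measure_pos
    proof eventually_elim
      case (elim g)
      then have "- (t * sqrt g)\<^sup>2 / 2 = g * (- t\<^sup>2 / 2)" by (simp add: power_mult_distrib)
      then show ?case by (simp only: exp_of_real[symmetric] of_real_mult[symmetric])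
    qed
  qed measurable
  finally show ?thesis .
qed

text \<open>Given the mixing value \<open>z\<close>, the count is Poisson with mean \<open>z\<close>
  and generating function \<open>exp (z * (w - 1))\<close>. On the closed unit disc the partial
  sums, weighted by \<open>exp (- z)\<close>, have norm at most 1, so summation and mixing may be
  exchanged.\<close>

lemma gen_negbin_pgf:
  assumes "0 < r" "\<alpha> \<noteq> 0" "0 < \<mu>" and w: "norm w \<le> 1"
  shows "(\<lambda>k. of_real (gen_negbin_prob r \<alpha> \<mu> k) * w ^ k) sums
     (CLINT z|gen_gamma_measure r \<alpha> \<mu>. exp (of_real z * (w - 1)))"
proof -
  let ?G = "gen_gamma_measure r \<alpha> \<mu>"
  interpret G: real_distribution ?G using assms by (intro real_distribution_gen_gamma_measure)
  have pos: "AE z in ?G. 0 < z" by (rule AE_gen_gamma_measure_pos)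
  have Gam: "0 < Gamma r" using assms by (intro Gamma_real_pos)
  have b: "(\<Sum>k<n. z ^ k / fact k) \<le> exp z" if "0 < z" for z :: real and n
  proof -
    have "(\<lambda>k. z ^ k / fact k) sums exp z"
      using exp_converges[of z] by (simp add: divide_inverse mult.commute)
    then show ?thesis using that sum_le_suminf[of "\<lambda>k. z ^ k / fact k" "{..<n}"]
      by (auto simp: sums_iff)
  qed
  have b1: "exp (- z) * (z ^ k / fact k) \<le> 1" if z: "0 < z" for z :: real and k :: nat
  proof -
    have "z ^ k / fact k \<le> (\<Sum>j<Suc k. z ^ j / fact j)"
      using z by (simp add: sum_nonneg)
    then have "z ^ k / fact k \<le> exp z" using b[OF z, of "Suc k"] by linarith
    from mult_left_mono[OF this, of "exp (- z)"] show ?thesis by (simp add: exp_minus)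
  qed
  have i: "integrable ?G (\<lambda>z. exp (- z) * (z ^ k / fact k))" for k
    by (rule G.integrable_const_bound[where B=1])
       (use pos in \<open>eventually_elim, use b1 in \<open>auto simp: abs_mult\<close>\<close>, measurable)
  have p: "gen_negbin_prob r \<alpha> \<mu> k = (LINT z|?G. exp (- z) * (z ^ k / fact k))" for k
  proof -
    have "(LINT z|?G. exp (- z) * (z ^ k / fact k)) = (LINT z|lborel. gen_gamma_density r \<alpha> \<mu> z *\<^sub>R (exp (- z) * (z ^ k / fact k)))"
      unfolding gen_gamma_measure_def using Gam assms
      by (intro integral_density) (auto simp: gen_gamma_density_def)
    also have "\<dots> = (LINT z|lborel. (1 / fact k) * (exp (- z) * z ^ k * gen_gamma_density r \<alpha> \<mu> z))"
      by (simp add: mult_ac)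
    also have "\<dots> = gen_negbin_prob r \<alpha> \<mu> k"
      unfolding gen_negbin_prob_def by (rule integral_mult_right_zero)
    finally show ?thesis ..
  qed
  let ?s = "\<lambda>n z. \<Sum>k<n. of_real (exp (- z) * (z ^ k / fact k)) * w ^ k :: complex"
  have part: "(\<Sum>k<n. of_real (gen_negbin_prob r \<alpha> \<mu> k) * w ^ k) = (CLINT z|?G. ?s n z)" for n
    unfolding p using i by (subst Bochner_Integration.integral_sum) (auto simp del: of_real_mult of_real_divide)
  have "(\<lambda>n. CLINT z|?G. ?s n z) \<longlonglongrightarrow> (CLINT z|?G. exp (of_real z * (w - 1)))"
  proof (rule integral_dominated_convergence[where w="\<lambda>_. 1"])
    show "AE z in ?G. (\<lambda>n. ?s n z) \<longlonglongrightarrow> exp (of_real z * (w - 1))"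
    proof (rule AE_I2)
      fix z
      have "(\<lambda>k. of_real (exp (- z)) * ((of_real z * w) ^ k /\<^sub>R fact k)) sums (of_real (exp (- z)) * exp (of_real z * w))"
        by (intro sums_mult exp_converges)
      also have "of_real (exp (- z)) * exp (of_real z * w) = exp (of_real z * (w - 1))"
        by (simp add: exp_of_real[symmetric] exp_add[symmetric] algebra_simps del: exp_of_real)
      also have "(\<lambda>k. of_real (exp (- z)) * ((of_real z * w) ^ k /\<^sub>R fact k)) = (\<lambda>k. of_real (exp (- z) * (z ^ k / fact k)) * w ^ k)"
        by (auto simp: scaleR_conv_of_real power_mult_distrib field_simps)
      finally show "(\<lambda>n. ?s n z) \<longlonglongrightarrow> exp (of_real z * (w - 1))" unfolding sums_def .
    qed
    show "AE z in ?G. norm (?s n z) \<le> 1" for n using pos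
    proof eventually_elim
      case (elim z)
      have "norm (?s n z) \<le> (\<Sum>k<n. exp (- z) * (z ^ k / fact k))"
      proof (rule order_trans[OF norm_sum sum_mono])
        fix k
        have "norm (w ^ k) \<le> 1" using w by (simp add: norm_power power_le_one)
        then show "norm (of_real (exp (- z) * (z ^ k / fact k)) * w ^ k) \<le> exp (- z) * (z ^ k / fact k)"
          unfolding norm_mult norm_of_real using elim
          by (subst abs_of_nonneg, simp, intro mult_left_le) auto
      qed
      also have "\<dots> = exp (- z) * (\<Sum>k<n. z ^ k / fact k)" by (rule sum_distrib_left[symmetric])
      also have "\<dots> \<le> exp (- z) * exp z" using b[OF elim] by (intro mult_left_mono) auto
      finally show ?case by (simp add: exp_minus)
    qed
  qed auto
  then show ?thesis unfolding sums_def part .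
qed

text \<open>Every preimage under \<open>f \<circ> X\<close> is a preimage under \<open>X\<close>, so
  independence passes to the smaller families; these are closed under intersection, hence it extends
  to the generated sigma-algebras.\<close>

lemma (in prob_space) indep_set_imp_indep_var:
  assumes ind: "indep_set {X -` A \<inter> space M | A. A \<in> sets S} {Y -` B \<inter> space M | B. B \<in> sets T}"
    and X: "X \<in> measurable M S" and Y: "Y \<in> measurable M T"
    and f: "f \<in> measurable S K" and g: "g \<in> measurable T L"
  shows "indep_var K (\<lambda>\<omega>. f (X \<omega>)) L (\<lambda>\<omega>. g (Y \<omega>))"
  unfolding indep_var_eq
proof (intro conjI indep_set_sigma_sets)
  show fX: "(\<lambda>\<omega>. f (X \<omega>)) \<in> measurable M K" using X f by measurable
  show gY: "(\<lambda>\<omega>. g (Y \<omega>)) \<in> measurable M L" using Y g by measurable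
  have sub: "{(\<lambda>\<omega>. h (Z \<omega>)) -` A \<inter> space M | A. A \<in> sets K} \<subseteq> {Z -` A \<inter> space M | A. A \<in> sets S}"
    if Z: "Z \<in> measurable M S" and h: "h \<in> measurable S K" for Z h S K
  proof safe
    fix A assume "A \<in> sets K"
    then have "h -` A \<inter> space S \<in> sets S" by (rule measurable_sets[OF h])
    moreover have "(\<lambda>\<omega>. h (Z \<omega>)) -` A \<inter> space M = Z -` (h -` A \<inter> space S) \<inter> space M"
      using measurable_space[OF Z] by auto
    ultimately show "\<exists>B. (\<lambda>\<omega>. h (Z \<omega>)) -` A \<inter> space M = Z -` B \<inter> space M \<and> B \<in> sets S" by blast
  qed
  show "indep_set {(\<lambda>\<omega>. f (X \<omega>)) -` A \<inter> space M | A. A \<in> sets K} {(\<lambda>\<omega>. g (Y \<omega>)) -` A \<inter> space M | A. A \<in> sets L}"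
    using ind sub[OF X f] sub[OF Y g] unfolding indep_set_def
    by (elim indep_sets_mono_sets) (auto split: bool.split)
  have st: "Int_stable {Z -` A \<inter> space M | A. A \<in> sets K}" for Z :: "'a \<Rightarrow> 'z" and K
  proof (rule Int_stableI, safe)
    fix A B assume "A \<in> sets K" "B \<in> sets K"
    then show "\<exists>C. Z -` A \<inter> space M \<inter> (Z -` B \<inter> space M) = Z -` C \<inter> space M \<and> C \<in> sets K"
      by (intro exI[of _ "A \<inter> B"]) auto
  qed
  show "Int_stable {(\<lambda>\<omega>. f (X \<omega>)) -` A \<inter> space M | A. A \<in> sets K}" by (rule st)
  show "Int_stable {(\<lambda>\<omega>. g (Y \<omega>)) -` A \<inter> space M | A. A \<in> sets L}" by (rule st)
qed

text \<open>Decompose over the value of \<open>N\<close>; on each event \<open>N = k\<close>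
  independence factors out the probability and leaves a sum of \<open>k\<close> i.i.d. terms. The
  result is a series in powers of \<open>char D t\<close>, so that it can be compared termwise with
  \<open>gen_negbin_pgf\<close>.\<close>

lemma (in prob_space) char_random_sum:
  fixes X :: "nat \<Rightarrow> 'a \<Rightarrow> real" and N :: "'a \<Rightarrow> nat"
  assumes X_indep: "indep_vars (\<lambda>_. borel) X UNIV"
    and X_ident: "\<And>i. distr M borel (X i) = D"
    and N[measurable]: "N \<in> measurable M (count_space UNIV)"
    and N_indep: "indep_set {N -` K \<inter> space M | K. K \<in> sets (count_space UNIV)}
           {(\<lambda>\<omega> i. X i \<omega>) -` E \<inter> space M | E. E \<in> sets (Pi\<^sub>M UNIV (\<lambda>_. borel))}"
  shows "(\<lambda>k. of_real (prob {\<omega> \<in> space M. N \<omega> = k}) * char D t ^ k) sums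
     (CLINT \<omega>|M. iexp (t * (\<Sum>i<N \<omega>. X i \<omega>)))"
proof -
  have X[measurable]: "X i \<in> borel_measurable M" for i
    using X_indep unfolding indep_vars_def2 by simp
  have S[measurable]: "(\<lambda>\<omega>. \<Sum>i<N \<omega>. X i \<omega>) \<in> borel_measurable M"
    by (rule measurable_compose_countable[where f="\<lambda>n \<omega>. \<Sum>i<n. X i \<omega>" and g=N]) auto
  let ?f = "\<lambda>k \<omega>. of_real (indicator {k} (N \<omega>)) * iexp (t * (\<Sum>i<k. X i \<omega>))"
  have term_eq: "(CLINT \<omega>|M. ?f k \<omega>) = of_real (prob {\<omega> \<in> space M. N \<omega> = k}) * char D t ^ k" for k
  proof -
    have ind: "indep_var borel (\<lambda>\<omega>. complex_of_real (indicator {k} (N \<omega>)))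
       borel (\<lambda>\<omega>. iexp (t * (\<Sum>i<k. X i \<omega>)))"
    proof (rule indep_set_imp_indep_var[OF N_indep])
      show "(\<lambda>x. iexp (t * (\<Sum>i<k. x i))) \<in> borel_measurable (Pi\<^sub>M UNIV (\<lambda>_. borel))"
        by measurable
      show "(\<lambda>\<omega> i. X i \<omega>) \<in> measurable M (Pi\<^sub>M UNIV (\<lambda>_. borel))"
        using measurable_restrict[of UNIV X M "\<lambda>_. borel", OF X] by (simp add: restrict_def)
    qed auto
    have "(CLINT \<omega>|M. ?f k \<omega>) = (CLINT \<omega>|M. complex_of_real (indicator {k} (N \<omega>))) * (CLINT \<omega>|M. iexp (t * (\<Sum>i<k. X i \<omega>)))"
      by (rule indep_var_lebesgue_integral[OF ind])
         (auto intro!: integrable_const_bound[where B=1] simp: indicator_def)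
    also have "(CLINT \<omega>|M. complex_of_real (indicator {k} (N \<omega>))) = of_real (LINT \<omega>|M. indicator {\<omega> \<in> space M. N \<omega> = k} \<omega>)"
      unfolding integral_complex_of_real[symmetric]
      by (rule Bochner_Integration.integral_cong) (auto simp: indicator_def)
    also have "(LINT \<omega>|M. indicator {\<omega> \<in> space M. N \<omega> = k} \<omega>) = prob {\<omega> \<in> space M. N \<omega> = k}"
      by simp
    also have "(CLINT \<omega>|M. iexp (t * (\<Sum>i<k. X i \<omega>))) = char (distr M borel (\<lambda>\<omega>. \<Sum>i<k. X i \<omega>)) t"
      unfolding char_def by (subst integral_distr) auto
    also have "\<dots> = (\<Prod>i<k. char (distr M borel (X i)) t)"
      by (rule char_distr_sum) (rule indep_vars_subset[OF X_indep], simp)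
    also have "\<dots> = char D t ^ k" by (simp add: X_ident)
    finally show ?thesis .
  qed
  have fi: "complex_integrable M (?f k)" for k
    by (rule integrable_const_bound[where B=1]) (auto simp: indicator_def norm_mult)
  have "(\<lambda>n. CLINT \<omega>|M. (\<Sum>k<n. ?f k \<omega>)) \<longlonglongrightarrow> (CLINT \<omega>|M. iexp (t * (\<Sum>i<N \<omega>. X i \<omega>)))"
  proof (rule integral_dominated_convergence[where w="\<lambda>_. 1"])
    \<comment> \<open>At most one summand is nonzero. Hence the partial sums have norm at most 1 and
      are eventually constant in \<open>n\<close> at each point.\<close>
    have sum_eq: "(\<Sum>k<n. ?f k \<omega>) = (if N \<omega> < n then iexp (t * (\<Sum>i<N \<omega>. X i \<omega>)) else 0)" for n \<omega>
    proof -
      have "(\<Sum>k<n. ?f k \<omega>) = (\<Sum>k<n. if k = N \<omega> then iexp (t * (\<Sum>i<N \<omega>. X i \<omega>)) else 0)"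
        by (rule sum.cong) (auto simp: indicator_def)
      also have "\<dots> = (if N \<omega> < n then iexp (t * (\<Sum>i<N \<omega>. X i \<omega>)) else 0)"
        by (subst sum.delta) auto
      finally show ?thesis .
    qed
    show "AE \<omega> in M. (\<lambda>n. \<Sum>k<n. ?f k \<omega>) \<longlonglongrightarrow> iexp (t * (\<Sum>i<N \<omega>. X i \<omega>))"
    proof (rule AE_I2)
      fix \<omega>
      have "\<forall>\<^sub>F n in sequentially. (\<Sum>k<n. ?f k \<omega>) = iexp (t * (\<Sum>i<N \<omega>. X i \<omega>))"
        unfolding sum_eq using eventually_gt_at_top[of "N \<omega>"] by (rule eventually_mono) simp
      then show "(\<lambda>n. \<Sum>k<n. ?f k \<omega>) \<longlonglongrightarrow> iexp (t * (\<Sum>i<N \<omega>. X i \<omega>))"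
        by (rule tendsto_eventually)
    qed
    show "(\<lambda>\<omega>. \<Sum>k<n. ?f k \<omega>) \<in> borel_measurable M" for n
      by (intro borel_measurable_sum borel_measurable_integrable fi)
    show "AE \<omega> in M. norm (\<Sum>k<n. ?f k \<omega>) \<le> 1" for n
      unfolding sum_eq by (rule AE_I2) (auto simp del: of_real_sum of_real_mult)
  qed auto
  then show ?thesis unfolding sums_def using fi by (simp only: Bochner_Integration.integral_sum term_eq)
qed

text \<open>The remainder bound with the minimum of a quadratic and a cubic term avoids a third
  moment: the cubic term gives pointwise convergence to 0, and the quadratic one is the integrable
  majorant. The index \<open>Suc n\<close> keeps the square root positive.\<close>

lemma char_second_order_limit:
  assumes D: "real_distribution D" and i: "integrable D (\<lambda>x. x)" "integrable D (\<lambda>x. x\<^sup>2)"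
    and mean: "(LINT x|D. x) = 0" and var: "(LINT x|D. x\<^sup>2) = \<sigma>\<^sup>2" and \<sigma>: "0 < \<sigma>"
  shows "(\<lambda>n. of_nat (Suc n) * (char D (t / (\<sigma> * sqrt (real (Suc n)))) - 1)) \<longlonglongrightarrow> of_real (- t\<^sup>2 / 2)"
proof -
  interpret real_distribution D by fact
  let ?t = "\<lambda>n. t / (\<sigma> * sqrt (real (Suc n)))"
  let ?I = "\<lambda>n. LINT x|D. min (6 * x\<^sup>2) (\<bar>?t n\<bar> * \<bar>x\<bar> ^ 3)"
  have t2: "(?t n)\<^sup>2 = t\<^sup>2 / \<sigma>\<^sup>2 / real (Suc n)" for n
    by (simp add: power_divide power_mult_distrib)
  have bnd: "norm (of_nat (Suc n) * (char D (?t n) - 1) - of_real (- t\<^sup>2 / 2)) \<le> t\<^sup>2 / (6 * \<sigma>\<^sup>2) * ?I n" for n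
  proof -
    have "of_nat (Suc n) * (char D (?t n) - 1) - of_real (- t\<^sup>2 / 2) = of_nat (Suc n) * (char D (?t n) - (1 - (?t n)\<^sup>2 * \<sigma>\<^sup>2 / 2))"
    proof -
      have "of_nat (Suc n) * complex_of_real ((?t n)\<^sup>2 * \<sigma>\<^sup>2 / 2) = of_real (t\<^sup>2 / 2)"
        unfolding t2 using \<sigma> by (simp add: field_simps del: of_nat_Suc)
      then show ?thesis by (simp add: right_diff_distrib del: of_nat_Suc)
    qed
    then have "norm (of_nat (Suc n) * (char D (?t n) - 1) - of_real (- t\<^sup>2 / 2)) = real (Suc n) * norm (char D (?t n) - (1 - (?t n)\<^sup>2 * \<sigma>\<^sup>2 / 2))"
      by (simp only: norm_mult norm_of_nat)
    also have "\<dots> \<le> real (Suc n) * ((?t n)\<^sup>2 / 6 * ?I n)"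
      by (intro mult_left_mono char_approx3) (use i mean var in auto)
    also have "\<dots> = t\<^sup>2 / (6 * \<sigma>\<^sup>2) * ?I n"
      unfolding t2 by (simp del: of_nat_Suc)
    finally show ?thesis .
  qed
  have t0: "?t \<longlonglongrightarrow> 0"
  proof -
    have "filterlim (\<lambda>n. \<sigma> * sqrt (real (Suc n))) at_top sequentially"
      using \<sigma> by (intro filterlim_tendsto_pos_mult_at_top[OF tendsto_const] filterlim_compose[OF sqrt_at_top]
          filterlim_compose[OF filterlim_real_sequentially filterlim_Suc])
    then show ?thesis by (intro tendsto_divide_0[OF tendsto_const] filterlim_at_top_imp_at_infinity)
  qed
  have "?I \<longlonglongrightarrow> (LINT x|D. 0)"
  proof (rule integral_dominated_convergence[where w="\<lambda>x. 6 * x\<^sup>2"])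
    show "AE x in D. (\<lambda>n. min (6 * x\<^sup>2) (\<bar>?t n\<bar> * \<bar>x\<bar> ^ 3)) \<longlonglongrightarrow> 0"
    proof (rule AE_I2)
      fix x
      have "(\<lambda>n. min (6 * x\<^sup>2) (\<bar>?t n\<bar> * \<bar>x\<bar> ^ 3)) \<longlonglongrightarrow> min (6 * x\<^sup>2) (\<bar>0\<bar> * \<bar>x\<bar> ^ 3)"
        by (intro tendsto_intros t0)
      then show "(\<lambda>n. min (6 * x\<^sup>2) (\<bar>?t n\<bar> * \<bar>x\<bar> ^ 3)) \<longlonglongrightarrow> 0" by (simp del: of_nat_Suc add: min_absorb2)
    qed
    show "AE x in D. norm (min (6 * x\<^sup>2) (\<bar>?t n\<bar> * \<bar>x\<bar> ^ 3)) \<le> 6 * x\<^sup>2" for n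
    proof (rule AE_I2)
      fix x
      have "0 \<le> min (6 * x\<^sup>2) (\<bar>?t n\<bar> * \<bar>x\<bar> ^ 3)"
        by (intro min.boundedI mult_nonneg_nonneg) auto
      then show "norm (min (6 * x\<^sup>2) (\<bar>?t n\<bar> * \<bar>x\<bar> ^ 3)) \<le> 6 * x\<^sup>2"
        by (simp only: real_norm_def abs_of_nonneg min.cobounded1)
    qed
    show "integrable D (\<lambda>x. 6 * x\<^sup>2)" using i by simp
  qed measurable
  then have "(\<lambda>n. t\<^sup>2 / (6 * \<sigma>\<^sup>2) * ?I n) \<longlonglongrightarrow> t\<^sup>2 / (6 * \<sigma>\<^sup>2) * 0"
    by (intro tendsto_mult_left) simp
  then have "(\<lambda>n. of_nat (Suc n) * (char D (?t n) - 1) - of_real (- t\<^sup>2 / 2)) \<longlonglongrightarrow> 0"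
    by (simp only: mult_zero_right) (rule Lim_null_comparison[OF always_eventually[OF allI[OF bnd]]])
  then show ?thesis by (rule LIM_zero_cancel)
qed

text \<open>After rescaling, the factor n moves from the measure into the exponent. The integrands
  have norm at most 1 because \<open>Re (w n)\<close> \<le> 1 and the mixing variable is
  positive.\<close>

lemma gen_gamma_mixture_limit:
  assumes "0 < r" "\<alpha> \<noteq> 0" and w: "\<And>n. norm (w n) \<le> 1"
    and lim: "(\<lambda>n. of_nat (Suc n) * (w n - 1)) \<longlonglongrightarrow> l"
  shows "(\<lambda>n. CLINT z|gen_gamma_measure r \<alpha> (1 / real (Suc n) powr \<alpha>). exp (of_real z * (w n - 1)))
     \<longlonglongrightarrow> (CLINT z|gen_gamma_measure r \<alpha> 1. exp (of_real z * l))"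
proof -
  let ?G = "gen_gamma_measure r \<alpha> 1"
  interpret G: real_distribution ?G using assms by (intro real_distribution_gen_gamma_measure) auto
  have "(CLINT z|gen_gamma_measure r \<alpha> (1 / real (Suc n) powr \<alpha>). exp (of_real z * (w n - 1)))
     = (CLINT z|?G. exp (of_real z * (of_nat (Suc n) * (w n - 1))))" for n
    using assms by (subst gen_gamma_measure_scale) (auto simp: integral_distr mult_ac simp del: of_nat_Suc)
  moreover have "(\<lambda>n. CLINT z|?G. exp (of_real z * (of_nat (Suc n) * (w n - 1)))) \<longlonglongrightarrow> (CLINT z|?G. exp (of_real z * l))"
  proof (rule integral_dominated_convergence[where w="\<lambda>_. 1"])
    show "AE z in ?G. (\<lambda>n. exp (of_real z * (of_nat (Suc n) * (w n - 1)))) \<longlonglongrightarrow> exp (of_real z * l)"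
      by (intro AE_I2 tendsto_intros lim)
    show "AE z in ?G. norm (exp (of_real z * (of_nat (Suc n) * (w n - 1)))) \<le> 1" for n
      using AE_gen_gamma_measure_pos
    proof eventually_elim
      case (elim z)
      have "Re (w n) \<le> 1" using complex_Re_le_cmod[of "w n"] w[of n] by linarith
      then have "z * (real (Suc n) * (Re (w n) - 1)) \<le> 0"
        using elim by (intro mult_nonneg_nonpos) auto
      then show ?case by (simp del: of_nat_Suc)
    qed
  qed auto
  ultimately show ?thesis by simp
qed

section \<open>The limit law\<close>

lemma gen_gamma_measure_eq_quotient:
  assumes S: "real_distribution S" and charS: "\<And>t. char S t = stable_char \<alpha> t"
    and \<alpha>: "0 < \<alpha>" "\<alpha> \<le> 1" and r: "0 < r" "r \<le> 1"
  shows "distr (std_exponential_measure \<Otimes>\<^sub>M S \<Otimes>\<^sub>M gamma_measure r \<Otimes>\<^sub>M gamma_measure (1 - r)) borel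
      (\<lambda>(w, s, g\<^sub>1, g\<^sub>2). w / (s * ((g\<^sub>1 + g\<^sub>2) / g\<^sub>1) powr (1 / \<alpha>))) = gen_gamma_measure r \<alpha> 1"
    (is "distr (?W \<Otimes>\<^sub>M S \<Otimes>\<^sub>M ?G1 \<Otimes>\<^sub>M ?G2) borel ?v = _")
proof (rule real_distribution_eqI_tail)
  interpret S: real_distribution S by fact
  interpret W: real_distribution ?W by (rule real_distribution_std_exponential_measure)
  interpret G1: real_distribution ?G1 using r by (intro real_distribution_gamma_measure) auto
  interpret G2: real_distribution ?G2 using r by (intro real_distribution_gamma_measure) auto
  interpret G: pair_prob_space ?G1 ?G2 ..
  interpret SG: pair_prob_space S "?G1 \<Otimes>\<^sub>M ?G2" ..
  interpret P: pair_prob_space ?W "S \<Otimes>\<^sub>M ?G1 \<Otimes>\<^sub>M ?G2" ..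
  have v[measurable]: "?v \<in> borel_measurable (?W \<Otimes>\<^sub>M S \<Otimes>\<^sub>M ?G1 \<Otimes>\<^sub>M ?G2)"
    by measurable
  show "real_distribution (distr (?W \<Otimes>\<^sub>M S \<Otimes>\<^sub>M ?G1 \<Otimes>\<^sub>M ?G2) borel ?v)"
    by (rule P.P.real_distribution_distr) measurable
  show G0: "real_distribution (gen_gamma_measure r \<alpha> 1)"
    using r \<alpha> by (intro real_distribution_gen_gamma_measure) auto
  interpret G0: real_distribution "gen_gamma_measure r \<alpha> 1" by (rule G0)
  fix x :: real
  let ?x = "max 0 x"
  let ?z = "\<lambda>g\<^sub>1 g\<^sub>2::real. (g\<^sub>1 + g\<^sub>2) / g\<^sub>1"
  let ?E = "?v -` {x<..} \<inter> space (?W \<Otimes>\<^sub>M S \<Otimes>\<^sub>M ?G1 \<Otimes>\<^sub>M ?G2)"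
  \<comment> \<open>Probability of the event given the other three variables. The exponential factor
    is integrated out first, then the stable one, and the two gamma factors last.\<close>
  let ?h = "\<lambda>q. emeasure ?W ((\<lambda>w. (w, q)) -` ?E)"
  have E: "?E \<in> sets (?W \<Otimes>\<^sub>M S \<Otimes>\<^sub>M ?G1 \<Otimes>\<^sub>M ?G2)" by measurable
  have hm[measurable]: "?h \<in> borel_measurable (S \<Otimes>\<^sub>M ?G1 \<Otimes>\<^sub>M ?G2)"
    by (rule P.measurable_emeasure_Pair2[OF E])
  have h: "?h (s, g\<^sub>1, g\<^sub>2) = ennreal (exp (- (?x * ?z g\<^sub>1 g\<^sub>2 powr (1 / \<alpha>)) * s))"
    if "0 < s" "0 < g\<^sub>1" "0 \<le> g\<^sub>2" for s g\<^sub>1 g\<^sub>2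
  proof -
    have "0 < s * ?z g\<^sub>1 g\<^sub>2 powr (1 / \<alpha>)" using that by simp
    from std_exponential_quotient_tail[OF this, of x] show ?thesis
      by (simp add: vimage_def space_pair_measure mult_ac)
  qed
  have "emeasure (distr (?W \<Otimes>\<^sub>M S \<Otimes>\<^sub>M ?G1 \<Otimes>\<^sub>M ?G2) borel ?v) {x<..} = (\<integral>\<^sup>+q. ?h q \<partial>(S \<Otimes>\<^sub>M ?G1 \<Otimes>\<^sub>M ?G2))"
    by (subst emeasure_distr) (auto simp: P.emeasure_pair_measure_alt2[OF E])
  also have "\<dots> = (\<integral>\<^sup>+p. \<integral>\<^sup>+s. ?h (s, p) \<partial>S \<partial>(?G1 \<Otimes>\<^sub>M ?G2))"
    by (rule SG.nn_integral_snd[symmetric]) measurable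
  also have "\<dots> = (\<integral>\<^sup>+g\<^sub>1. \<integral>\<^sup>+g\<^sub>2. \<integral>\<^sup>+s. ?h (s, g\<^sub>1, g\<^sub>2) \<partial>S \<partial>?G2 \<partial>?G1)"
    by (rule G2.nn_integral_fst[symmetric]) measurable
  also have "\<dots> = (\<integral>\<^sup>+g\<^sub>1. \<integral>\<^sup>+g\<^sub>2. ennreal (exp (- (?x powr \<alpha>) * ?z g\<^sub>1 g\<^sub>2)) \<partial>?G2 \<partial>?G1)"
  proof (rule nn_integral_cong_AE)
    show "AE g\<^sub>1 in ?G1. (\<integral>\<^sup>+g\<^sub>2. \<integral>\<^sup>+s. ?h (s, g\<^sub>1, g\<^sub>2) \<partial>S \<partial>?G2) = (\<integral>\<^sup>+g\<^sub>2. ennreal (exp (- (?x powr \<alpha>) * ?z g\<^sub>1 g\<^sub>2)) \<partial>?G2)"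
      using AE_gamma_measure_pos[OF r(1)]
    proof eventually_elim
      fix g\<^sub>1 :: real assume g1: "0 < g\<^sub>1"
      show "(\<integral>\<^sup>+g\<^sub>2. \<integral>\<^sup>+s. ?h (s, g\<^sub>1, g\<^sub>2) \<partial>S \<partial>?G2) = (\<integral>\<^sup>+g\<^sub>2. ennreal (exp (- (?x powr \<alpha>) * ?z g\<^sub>1 g\<^sub>2)) \<partial>?G2)"
      proof (rule nn_integral_cong_AE)
        \<comment> \<open>Only nonnegativity is available, since at r = 1 this variable is 0. The
          ratio remains positive because \<open>g\<^sub>1\<close> is.\<close>
        have "AE g\<^sub>2 in ?G2. 0 \<le> g\<^sub>2" using r by (intro AE_gamma_measure_nonneg) simp
        then show "AE g\<^sub>2 in ?G2. (\<integral>\<^sup>+s. ?h (s, g\<^sub>1, g\<^sub>2) \<partial>S) = ennreal (exp (- (?x powr \<alpha>) * ?z g\<^sub>1 g\<^sub>2))"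
        proof eventually_elim
          fix g\<^sub>2 :: real assume g2: "0 \<le> g\<^sub>2"
          have z: "0 < ?z g\<^sub>1 g\<^sub>2" using g1 g2 by simp
          have "(\<integral>\<^sup>+s. ?h (s, g\<^sub>1, g\<^sub>2) \<partial>S) = (\<integral>\<^sup>+s. ennreal (exp (- (?x * ?z g\<^sub>1 g\<^sub>2 powr (1 / \<alpha>)) * s)) \<partial>S)"
            by (rule nn_integral_cong_AE)
               (use stable_pos[OF S charS \<alpha>] in \<open>eventually_elim, use h g1 g2 in blast\<close>)
          also have "\<dots> = ennreal (exp (- (?x powr \<alpha>) * ?z g\<^sub>1 g\<^sub>2))"
          proof (cases "0 < x")
            case True
            \<comment> \<open>Here the exponent 1 / \<alpha> meets the power \<alpha> of the stable
              Laplace transform, leaving an expression linear in Z.\<close>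
            have "(?x * ?z g\<^sub>1 g\<^sub>2 powr (1 / \<alpha>)) powr \<alpha> = ?x powr \<alpha> * ?z g\<^sub>1 g\<^sub>2"
              using True g1 g2 \<alpha> by (simp add: powr_mult powr_powr)
            moreover have "0 < ?x * ?z g\<^sub>1 g\<^sub>2 powr (1 / \<alpha>)"
              using True g1 g2 by (intro mult_pos_pos) auto
            ultimately show ?thesis
              using nn_integral_stable_laplace[OF S charS \<alpha>, of "?x * ?z g\<^sub>1 g\<^sub>2 powr (1 / \<alpha>)"]
              by (simp only: mult_minus_left)
          next
            case False
            then show ?thesis by (simp add: max_def S.emeasure_space_1[unfolded S.space_eq_univ])
          qed
          finally show "(\<integral>\<^sup>+s. ?h (s, g\<^sub>1, g\<^sub>2) \<partial>S) = ennreal (exp (- (?x powr \<alpha>) * ?z g\<^sub>1 g\<^sub>2))" .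
        qed
      qed
    qed
  qed
  also have "\<dots> = emeasure (gen_gamma_measure r \<alpha> 1) {x<..}"
  proof (cases "0 < x")
    case True
    then show ?thesis
      using nn_integral_gamma_mixture_tail[OF r, of "x powr \<alpha>"] emeasure_gen_gamma_measure_tail[OF r(1) \<alpha>(1) True]
      by (simp add: max_def)
  next
    case False
    have "emeasure (gen_gamma_measure r \<alpha> 1) {x<..} = 1"
    proof (rule G0.emeasure_eq_1_AE)
      show "AE y in gen_gamma_measure r \<alpha> 1. y \<in> {x<..}"
        using AE_gen_gamma_measure_pos by eventually_elim (use False in auto)
    qed auto
    then show ?thesis using False
      by (simp add: max_def G1.emeasure_space_1[unfolded G1.space_eq_univ] G2.emeasure_space_1[unfolded G2.space_eq_univ])
  qed
  finally show "emeasure (distr (?W \<Otimes>\<^sub>M S \<Otimes>\<^sub>M ?G1 \<Otimes>\<^sub>M ?G2) borel ?v) {x<..} = emeasure (gen_gamma_measure r \<alpha> 1) {x<..}" .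
qed

section \<open>Substituting representations into independent factors\<close>

lemma distr_pair_distr_snd:
  assumes "prob_space Q" and f[measurable]: "f \<in> measurable Q T" and g[measurable]: "g \<in> measurable (K \<Otimes>\<^sub>M T) L"
  shows "distr (K \<Otimes>\<^sub>M distr Q T f) L g = distr (K \<Otimes>\<^sub>M Q) L (\<lambda>(x, q). g (x, f q))"
proof -
  interpret Q: prob_space Q by fact
  interpret fQ: prob_space "distr Q T f" by (rule Q.prob_space_distr) measurable
  have "K \<Otimes>\<^sub>M distr Q T f = distr K K (\<lambda>x. x) \<Otimes>\<^sub>M distr Q T f" by (simp add: distr_id2)
  also have "\<dots> = distr (K \<Otimes>\<^sub>M Q) (K \<Otimes>\<^sub>M T) (\<lambda>(x, q). (x, f q))"
    by (rule pair_measure_distr) (auto intro: fQ.sigma_finite_measure_axioms)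
  finally show ?thesis by (simp add: distr_distr o_def split_beta')
qed

lemma distr_pair_distr_fst:
  assumes "prob_space Q" and f[measurable]: "f \<in> measurable K T" and g[measurable]: "g \<in> measurable (T \<Otimes>\<^sub>M Q) L"
  shows "distr (distr K T f \<Otimes>\<^sub>M Q) L g = distr (K \<Otimes>\<^sub>M Q) L (\<lambda>(x, q). g (f x, q))"
proof -
  interpret Q: prob_space Q by fact
  have id: "distr Q Q (\<lambda>x. x) = Q" by (simp add: distr_id2)
  have "distr K T f \<Otimes>\<^sub>M Q = distr K T f \<Otimes>\<^sub>M distr Q Q (\<lambda>x. x)" by (simp add: id)
  also have "\<dots> = distr (K \<Otimes>\<^sub>M Q) (T \<Otimes>\<^sub>M Q) (\<lambda>(x, q). (f x, q))"
    by (rule pair_measure_distr) (auto simp: id intro: Q.sigma_finite_measure_axioms)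
  finally show ?thesis by (simp add: distr_distr o_def split_beta')
qed

lemma limit_law_representations:
  assumes S: "real_distribution S" and charS: "\<And>t. char S t = stable_char \<alpha> t"
    and \<alpha>: "0 < \<alpha>" "\<alpha> \<le> 1" and r: "0 < r" "r \<le> 1"
  shows "limit_law r \<alpha> = repr_law1 S r \<alpha>" "limit_law r \<alpha> = repr_law2 S r \<alpha>"
proof -
  let ?N = "std_normal_measure" and ?W = "std_exponential_measure"
  let ?G1 = "gamma_measure r" and ?G2 = "gamma_measure (1 - r)"
  interpret S: real_distribution S by fact
  interpret N: real_distribution ?N by (rule real_distribution_std_normal_measure)
  interpret W: real_distribution ?W by (rule real_distribution_std_exponential_measure)
  interpret G1: real_distribution ?G1 using r by (intro real_distribution_gamma_measure) auto
  interpret G2: real_distribution ?G2 using r by (intro real_distribution_gamma_measure) auto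
  interpret G: pair_prob_space ?G1 ?G2 ..
  let ?Q = "S \<Otimes>\<^sub>M ?G1 \<Otimes>\<^sub>M ?G2"
  interpret SG: pair_prob_space S "?G1 \<Otimes>\<^sub>M ?G2" ..
  interpret P: pair_prob_space ?W ?Q ..
  let ?v = "\<lambda>(w, s, g\<^sub>1, g\<^sub>2). w / (s * ((g\<^sub>1 + g\<^sub>2) / g\<^sub>1) powr (1 / \<alpha>))"
  have "limit_law r \<alpha> = distr (?N \<Otimes>\<^sub>M distr (?W \<Otimes>\<^sub>M ?Q) borel ?v) borel (\<lambda>(x, g). x * sqrt g)"
    unfolding limit_law_def gen_gamma_measure_eq_quotient[OF assms] ..
  also have "\<dots> = distr (?N \<Otimes>\<^sub>M ?W \<Otimes>\<^sub>M ?Q) borel (\<lambda>(x, q). case (x, ?v q) of (x, g) \<Rightarrow> x * sqrt g)"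
    by (rule distr_pair_distr_snd[OF P.P.prob_space_axioms]) measurable
  also have "\<dots> = repr_law1 S r \<alpha>"
    unfolding repr_law1_def by (simp add: split_beta')
  finally show 1: "limit_law r \<alpha> = repr_law1 S r \<alpha>" .
  let ?l = "\<lambda>(l, s, g\<^sub>1, g\<^sub>2). l / sqrt (2 * s * ((g\<^sub>1 + g\<^sub>2) / g\<^sub>1) powr (1 / \<alpha>))"
  have as: "(\<lambda>((x, y), z). (x, (y, z))) \<in> measurable ((?N \<Otimes>\<^sub>M ?W) \<Otimes>\<^sub>M ?Q) (?N \<Otimes>\<^sub>M (?W \<Otimes>\<^sub>M ?Q))"
    unfolding split_beta' by measurable
  have "repr_law2 S r \<alpha> = distr (distr (?N \<Otimes>\<^sub>M ?W) borel (\<lambda>(x, w). x * sqrt (2 * w)) \<Otimes>\<^sub>M ?Q) borel ?l"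
    unfolding repr_law2_def laplace_measure_eq_normal_mixture ..
  also have "\<dots> = distr ((?N \<Otimes>\<^sub>M ?W) \<Otimes>\<^sub>M ?Q) borel (\<lambda>(p, q). ?l ((\<lambda>(x, w). x * sqrt (2 * w)) p, q))"
    by (rule distr_pair_distr_fst[OF SG.P.prob_space_axioms]) measurable
  \<comment> \<open>The 2 under the root of the mixture cancels the 2 in the denominator of
    \<open>repr_law2\<close>. The identity is pointwise on all reals, \<open>sqrt\<close> being
    multiplicative also for negative arguments.\<close>
  also have "(\<lambda>(p, q). ?l ((\<lambda>(x, w). x * sqrt (2 * w)) p, q))
     = (\<lambda>(x, w, s, g\<^sub>1, g\<^sub>2). x * sqrt (w / (s * ((g\<^sub>1 + g\<^sub>2) / g\<^sub>1) powr (1 / \<alpha>)))) \<circ> (\<lambda>((x, y), z). (x, (y, z)))"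
    by (auto simp: fun_eq_iff real_sqrt_divide real_sqrt_mult)
  also have "distr ((?N \<Otimes>\<^sub>M ?W) \<Otimes>\<^sub>M ?Q) borel \<dots>
     = distr (distr ((?N \<Otimes>\<^sub>M ?W) \<Otimes>\<^sub>M ?Q) (?N \<Otimes>\<^sub>M (?W \<Otimes>\<^sub>M ?Q)) (\<lambda>((x, y), z). (x, (y, z)))) borel
        (\<lambda>(x, w, s, g\<^sub>1, g\<^sub>2). x * sqrt (w / (s * ((g\<^sub>1 + g\<^sub>2) / g\<^sub>1) powr (1 / \<alpha>))))"
    by (rule distr_distr[symmetric, OF _ as]) measurable
  also have "\<dots> = repr_law1 S r \<alpha>"
    unfolding repr_law1_def
    by (subst pair_measure_assoc)
      (auto intro: N.sigma_finite_measure_axioms W.sigma_finite_measure_axioms SG.P.sigma_finite_measure_axioms)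
  finally show "limit_law r \<alpha> = repr_law2 S r \<alpha>" using 1 by simp
qed

text \<open>At index 0 the normalisation divides by 0 and nothing is assumed about
  \<open>N 0\<close>; the limit is taken along \<open>Suc n\<close> instead.\<close>

lemma weak_conv_m_Suc:
  assumes "weak_conv_m (\<lambda>n. M (Suc n)) L" shows "weak_conv_m M L"
  unfolding weak_conv_m_def weak_conv_def
proof (intro allI impI)
  fix x assume "isCont (cdf L) x"
  then have "(\<lambda>n. cdf (M (Suc n)) x) \<longlonglongrightarrow> cdf L x"
    using assms unfolding weak_conv_m_def weak_conv_def by blast
  then show "(\<lambda>n. cdf (M n) x) \<longlonglongrightarrow> cdf L x" by (rule LIMSEQ_imp_Suc)
qed

text \<open>Equality in distribution is equality of measures, and the stable law appears as an
  arbitrary law with the prescribed characteristic function. Independence is required of each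
  \<open>N n\<close> from the whole sequence, one n at a time, since weak convergence involves only
  the law of each normalised sum.\<close>

theorem theorem8:
  fixes M :: "'a measure" and X :: "nat \<Rightarrow> 'a \<Rightarrow> real" and N :: "nat \<Rightarrow> 'a \<Rightarrow> nat"
    and \<sigma> r \<alpha> :: real
  assumes "prob_space M"
    and X_meas: "\<And>i. X i \<in> borel_measurable M"
    and X_indep: "prob_space.indep_vars M (\<lambda>_. borel) X UNIV"
    and X_ident: "\<And>i. distr M borel (X i) = distr M borel (X 0)"
    and X_int: "integrable M (\<lambda>\<omega>. (X 0 \<omega>)\<^sup>2)"
    and X_mean: "prob_space.expectation M (X 0) = 0"
    and \<sigma>_pos: "\<sigma> > 0"
    and X_var: "prob_space.variance M (X 0) = \<sigma>\<^sup>2"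
    and r_pos: "r > 0" and \<alpha>_nz: "\<alpha> \<noteq> 0"
    and N_meas: "\<And>n. n \<ge> 1 \<Longrightarrow> N n \<in> measurable M (count_space UNIV)"
    and N_dist: "\<And>n k. n \<ge> 1 \<Longrightarrow>
         prob_space.prob M {\<omega> \<in> space M. N n \<omega> = k} = gen_negbin_prob r \<alpha> (1 / real n powr \<alpha>) k"
    and N_indep: "\<And>n. n \<ge> 1 \<Longrightarrow>
         prob_space.indep_set M
           {N n -` K \<inter> space M | K. K \<in> sets (count_space UNIV)}
           {(\<lambda>\<omega> i. X i \<omega>) -` E \<inter> space M | E. E \<in> sets (Pi\<^sub>M UNIV (\<lambda>_. borel))}"
  shows "weak_conv_m
           (\<lambda>n. distr M borel (\<lambda>\<omega>. (\<Sum>i<N n \<omega>. X i \<omega>) / (\<sigma> * sqrt (real n))))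
           (limit_law r \<alpha>)
       \<and> (r \<le> 1 \<and> 0 < \<alpha> \<and> \<alpha> \<le> 1 \<longrightarrow>
           (\<forall>S\<mu>. real_distribution S\<mu> \<and> (\<forall>t. char S\<mu> t = stable_char \<alpha> t) \<longrightarrow>
              limit_law r \<alpha> = repr_law1 S\<mu> r \<alpha> \<and> limit_law r \<alpha> = repr_law2 S\<mu> r \<alpha>))"
proof (intro conjI impI allI; (elim conjE)?)
  interpret prob_space M by fact
  define D where "D = distr M borel (X 0)"
  have X0[measurable]: "X i \<in> borel_measurable M" for i by (rule X_meas)
  have D: "real_distribution D" unfolding D_def by (rule real_distribution_distr) measurable
  interpret D: real_distribution D by (rule D)
  have Xi: "integrable M (X 0)"
    by (rule square_integrable_imp_integrable[OF _ X_int]) measurable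
  have Di: "integrable D (\<lambda>x. x)" "integrable D (\<lambda>x. x\<^sup>2)"
    and Dm: "(LINT x|D. x) = 0" "(LINT x|D. x\<^sup>2) = \<sigma>\<^sup>2"
    using Xi X_int X_mean X_var by (simp_all add: D_def integrable_distr_eq integral_distr)
  let ?L = "\<lambda>n. distr M borel (\<lambda>\<omega>. (\<Sum>i<N n \<omega>. X i \<omega>) / (\<sigma> * sqrt (real n)))"
  have S[measurable]: "(\<lambda>\<omega>. \<Sum>i<N (Suc n) \<omega>. X i \<omega>) \<in> borel_measurable M" for n
    using N_meas[of "Suc n"]
    by (intro measurable_compose_countable[where f="\<lambda>n \<omega>. \<Sum>i<n. X i \<omega>" and g="N (Suc n)"]) auto
  show "weak_conv_m ?L (limit_law r \<alpha>)"
  proof (rule weak_conv_m_Suc, rule levy_continuity)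
    show "real_distribution (?L (Suc n))" for n
      by (rule real_distribution_distr) measurable
    show "real_distribution (limit_law r \<alpha>)" using r_pos \<alpha>_nz by (rule real_distribution_limit_law)
    fix t
    let ?w = "\<lambda>n. char D (t / (\<sigma> * sqrt (real (Suc n))))"
    have eq: "char (?L (Suc n)) t = (CLINT z|gen_gamma_measure r \<alpha> (1 / real (Suc n) powr \<alpha>). exp (of_real z * (?w n - 1)))" for n
    proof -
      have a: "char (?L (Suc n)) t = (CLINT \<omega>|M. iexp (t / (\<sigma> * sqrt (real (Suc n))) * (\<Sum>i<N (Suc n) \<omega>. X i \<omega>)))"
        unfolding char_def by (subst integral_distr) (auto simp del: of_nat_Suc)
      have b: "(\<lambda>k. of_real (prob {\<omega> \<in> space M. N (Suc n) \<omega> = k}) * ?w n ^ k) sums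
         (CLINT \<omega>|M. iexp (t / (\<sigma> * sqrt (real (Suc n))) * (\<Sum>i<N (Suc n) \<omega>. X i \<omega>)))"
        by (rule char_random_sum[OF X_indep _ N_meas N_indep]) (auto simp: D_def intro: X_ident)
      have c: "(\<lambda>k. of_real (gen_negbin_prob r \<alpha> (1 / real (Suc n) powr \<alpha>) k) * ?w n ^ k) sums
         (CLINT z|gen_gamma_measure r \<alpha> (1 / real (Suc n) powr \<alpha>). exp (of_real z * (?w n - 1)))"
        by (rule gen_negbin_pgf[OF r_pos \<alpha>_nz _ D.cmod_char_le_1]) simp
      have d: "prob {\<omega> \<in> space M. N (Suc n) \<omega> = k} = gen_negbin_prob r \<alpha> (1 / real (Suc n) powr \<alpha>) k" for k
        by (rule N_dist) simp
      \<comment> \<open>Series \<open>b\<close> and \<open>c\<close> have the same terms by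
        \<open>d\<close>, so their sums agree; this transfers the mixed Poisson formula to the
        random sum.\<close>
      show ?thesis unfolding a by (rule sums_unique2[OF b[unfolded d] c])
    qed
    have "(\<lambda>n. of_nat (Suc n) * (?w n - 1)) \<longlonglongrightarrow> of_real (- t\<^sup>2 / 2)"
      by (rule char_second_order_limit[OF D Di Dm \<sigma>_pos])
    from gen_gamma_mixture_limit[OF r_pos \<alpha>_nz D.cmod_char_le_1 this]
    show "(\<lambda>n. char (?L (Suc n)) t) \<longlonglongrightarrow> char (limit_law r \<alpha>) t"
      unfolding eq char_limit_law[OF r_pos \<alpha>_nz] .
  qed
next
  fix S\<mu> assume "r \<le> 1" "0 < \<alpha>" "\<alpha> \<le> 1" "real_distribution S\<mu>" "\<forall>t. char S\<mu> t = stable_char \<alpha> t"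
  then show "limit_law r \<alpha> = repr_law1 S\<mu> r \<alpha>" "limit_law r \<alpha> = repr_law2 S\<mu> r \<alpha>"
    using limit_law_representations[of S\<mu> \<alpha> r] r_pos by auto
qed

end
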